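(* For every computable order $h$, there exists an $\omega$-model of $\mathsf{DNC}_h$ which is not a model of $\mathsf{RCOLOR}_2$. Equivalently: there is a Turing ideal $\mathcal{S}\subseteq 2^\omega$ such that (i) for every $X\in\mathcal{S}$ there is an $h$-bounded function $f\in\mathcal{S}$ which is diagonally non-computable relative to $X$, and (ii) there is an infinite, locally $2$-colorable graph $G\in\mathcal{S}$ with no infinite set $H\in\mathcal{S}$ that is $2$-homogeneous for $G$.
   Context: An order is a non-decreasing, unbounded function $h:\omega\to\omega$. A function $f$ is $h$-bounded if $f(x)\le h(x)$ for all $x$. Fix an effective enumeration $\Phi_0,\Phi_1,\dots$ of Turing functionals; $f$ is diagonally non-computable (d.n.c.) relative to $X$ if $f(e)\neq\Phi^X_e(e)$ for every $e$. $\mathsf{DNC}_h$ is the statement "for every set $X$ there exists an $h$-bounded function d.n.c. relative to $X$". A graph $G=(V,E)$ is locally $2$-colorable if every finite subgraph is $2$-colorable. A set $H\subseteq V$ is $2$-homogeneous for $G$ if every finite $V_0\subseteq V$ induces a subgraph that is $2$-colorable by a coloring giving every vertex of $V_0\cap H$ color $0$. $\mathsf{RCOLOR}_2$ is the statement "for every infinite, locally $2$-colorable graph $G=(V,E)$ there is an infinite $H\subseteq V$ that is $2$-homogeneous for $G$". An $\omega$-model is an $\omega$-structure of $\mathsf{RCA}_0$ with standard integers, determined by its second-order part, which is a Turing ideal (a set of reals closed under Turing join and downward closed under Turing reducibility).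
   Formalization: The order h is additionally required to satisfy h(0) > 0; in the enumeration fixed here, the functional with index 0 is constantly 0, so an order with h(0) = 0 leaves no admissible value f(0) and DNC_h has no ω-model. *)

theory Defs
  imports Main "HOL-Library.Nat_Bijection"
begin

section \<open>Oracle computability\<close>

text \<open>
  Partial recursive functions relative to an oracle \<open>X\<close>, presented as unary functions on
  \<open>nat\<close>; several arguments are packed with the Cantor pairing \<^const>\<open>prod_encode\<close>.
  The identity is \<open>PPair PFst PSnd\<close>, so no separate constructor is needed for it.
\<close>

datatype prog =
    PZero | PSucc | PFst | PSnd | POracle
  | PPair prog prog | PComp prog prog | PRec prog prog | PMu prog

text \<open>
  \<open>None\<close> means divergence. \<open>PRec p q\<close> maps \<open>(a, 0)\<close> to \<open>p(a)\<close> and \<open>(a, k + 1)\<close> to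
  \<open>q(a, k, y)\<close>, where \<open>y\<close> is the value at \<open>(a, k)\<close>. \<open>PMu p\<close> maps \<open>a\<close> to the least \<open>m\<close>
  with \<open>p(a, m) = 0\<close>, provided \<open>p(a, k)\<close> converges for all \<open>k < m\<close>.
\<close>

primrec eval :: "nat set \<Rightarrow> prog \<Rightarrow> nat \<Rightarrow> nat option" where
  "eval X PZero = (\<lambda>n. Some 0)"
| "eval X PSucc = (\<lambda>n. Some (Suc n))"
| "eval X PFst = (\<lambda>n. Some (fst (prod_decode n)))"
| "eval X PSnd = (\<lambda>n. Some (snd (prod_decode n)))"
| "eval X POracle = (\<lambda>n. Some (if n \<in> X then 1 else 0))"
| "eval X (PPair p q) = (\<lambda>n. Option.bind (eval X p n) (\<lambda>a.
     Option.bind (eval X q n) (\<lambda>b. Some (prod_encode (a, b)))))"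
| "eval X (PComp p q) = (\<lambda>n. Option.bind (eval X q n) (eval X p))"
| "eval X (PRec p q) = (\<lambda>n. case prod_decode n of (a, m) \<Rightarrow>
     rec_nat (eval X p a)
       (\<lambda>k r. Option.bind r (\<lambda>y. eval X q (prod_encode (a, prod_encode (k, y))))) m)"
| "eval X (PMu p) = (\<lambda>a.
     if \<exists>m. eval X p (prod_encode (a, m)) = Some 0 \<and>
            (\<forall>k<m. eval X p (prod_encode (a, k)) \<noteq> None)
     then Some (LEAST m. eval X p (prod_encode (a, m)) = Some 0)
     else None)"

text \<open>A Goedel numbering: \<open>decode\<close> is in fact a bijection between \<open>nat\<close> and programs.\<close>

function decode :: "nat \<Rightarrow> prog" where
  "decode n =
    (if n = 0 then PZero
     else if n = 1 then PSucc
     else if n = 2 then PFst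
     else if n = 3 then PSnd
     else if n = 4 then POracle
     else let i = (n - 5) mod 4; c = (n - 5) div 4;
              a = fst (prod_decode c); b = snd (prod_decode c) in
       if i = 0 then PPair (decode a) (decode b)
       else if i = 1 then PComp (decode a) (decode b)
       else if i = 2 then PRec (decode a) (decode b)
       else PMu (decode c))"
  by auto

lemma prod_decode_le: "fst (prod_decode c) \<le> c" "snd (prod_decode c) \<le> c"
  using le_prod_encode_1[of "fst (prod_decode c)" "snd (prod_decode c)"]
    le_prod_encode_2[of "snd (prod_decode c)" "fst (prod_decode c)"] by simp_all

termination decode
proof -
  have less: "(n - 5) div 4 < n" "fst (prod_decode ((n - 5) div 4)) < n"
      "snd (prod_decode ((n - 5) div 4)) < n" if "n \<noteq> 0" for n :: nat
    using prod_decode_le[of "(n - 5) div 4"] that by linarith+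
  show ?thesis
    by (relation "measure id") (simp_all only: wf_measure in_measure id_apply less not_False_eq_True)
qed

declare decode.simps [simp del]

lemma decode_add5:
  assumes "i < 4"
  shows "decode (4 * c + i + 5) =
    (let a = fst (prod_decode c); b = snd (prod_decode c) in
       if i = 0 then PPair (decode a) (decode b)
       else if i = 1 then PComp (decode a) (decode b)
       else if i = 2 then PRec (decode a) (decode b)
       else PMu (decode c))"
proof -
  define n where "n = 4 * c + i + 5"
  have "n \<noteq> 0" "n \<noteq> 1" "n \<noteq> 2" "n \<noteq> 3" "n \<noteq> 4" "(n - 5) mod 4 = i" "(n - 5) div 4 = c"
    using assms by (simp_all add: n_def)
  then show ?thesis
    unfolding n_def [symmetric] by (subst decode.simps) (simp only: Let_def if_False)
qed

lemma surj_decode: "surj decode"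
proof -
  have "\<exists>n. decode n = p" for p
  proof (induction p)
    case PZero
    show ?case by (rule exI[of _ 0]) (simp add: decode.simps)
  next
    case PSucc
    show ?case by (rule exI[of _ 1]) (simp add: decode.simps)
  next
    case PFst
    show ?case by (rule exI[of _ 2]) (simp add: decode.simps)
  next
    case PSnd
    show ?case by (rule exI[of _ 3]) (simp add: decode.simps)
  next
    case POracle
    show ?case by (rule exI[of _ 4]) (simp add: decode.simps)
  next
    case (PPair p q)
    then obtain a b where "decode a = p" "decode b = q" by blast
    then have "decode (4 * prod_encode (a, b) + 0 + 5) = PPair p q"
      by (subst decode_add5) simp_all
    then show ?case ..
  next
    case (PComp p q)
    then obtain a b where "decode a = p" "decode b = q" by blast
    then have "decode (4 * prod_encode (a, b) + 1 + 5) = PComp p q"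
      by (subst decode_add5) simp_all
    then show ?case ..
  next
    case (PRec p q)
    then obtain a b where "decode a = p" "decode b = q" by blast
    then have "decode (4 * prod_encode (a, b) + 2 + 5) = PRec p q"
      by (subst decode_add5) simp_all
    then show ?case ..
  next
    case (PMu p)
    then obtain a where "decode a = p" by blast
    then have "decode (4 * a + 3 + 5) = PMu p"
      by (subst decode_add5) simp_all
    then show ?case ..
  qed
  then show ?thesis by (metis surjI)
qed

definition Phi :: "nat \<Rightarrow> nat set \<Rightarrow> nat \<Rightarrow> nat option" where
  "Phi e X n = eval X (decode e) n"

definition computable :: "(nat \<Rightarrow> nat) \<Rightarrow> bool" where
  "computable f \<longleftrightarrow> (\<exists>e. \<forall>n. Phi e {} n = Some (f n))"

definition turing_le :: "nat set \<Rightarrow> nat set \<Rightarrow> bool" where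
  "turing_le A B \<longleftrightarrow> (\<exists>e. \<forall>n. Phi e B n = Some (if n \<in> A then 1 else 0))"

definition turing_join :: "nat set \<Rightarrow> nat set \<Rightarrow> nat set" where
  "turing_join A B = (\<lambda>n. 2 * n) ` A \<union> (\<lambda>n. 2 * n + 1) ` B"

text \<open>
  Nonemptiness is part of the definition: the second-order part of an \<open>\<omega>\<close>-model of
  \<open>RCA\<^sub>0\<close> contains all computable sets.
\<close>

definition turing_ideal :: "nat set set \<Rightarrow> bool" where
  "turing_ideal S \<longleftrightarrow> S \<noteq> {} \<and>
     (\<forall>X\<in>S. \<forall>Y\<in>S. turing_join X Y \<in> S) \<and>
     (\<forall>Y\<in>S. \<forall>X. turing_le X Y \<longrightarrow> X \<in> S)"


section \<open>Diagonal non-computability\<close>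

definition is_order :: "(nat \<Rightarrow> nat) \<Rightarrow> bool" where
  "is_order h \<longleftrightarrow> mono h \<and> (\<forall>b. \<exists>x. b < h x)"

definition h_bounded :: "(nat \<Rightarrow> nat) \<Rightarrow> (nat \<Rightarrow> nat) \<Rightarrow> bool" where
  "h_bounded h f \<longleftrightarrow> (\<forall>x. f x \<le> h x)"

definition dnc :: "(nat \<Rightarrow> nat) \<Rightarrow> nat set \<Rightarrow> bool" where
  "dnc f X \<longleftrightarrow> (\<forall>e. Phi e X e \<noteq> Some (f e))"

text \<open>A relation on \<open>nat\<close> or a function \<open>nat \<Rightarrow> nat\<close> belongs to a second-order part if the
  corresponding set of coded pairs does.\<close>

definition rel_code :: "(nat \<times> nat) set \<Rightarrow> nat set" where
  "rel_code R = prod_encode ` R"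

definition fun_code :: "(nat \<Rightarrow> nat) \<Rightarrow> nat set" where
  "fun_code f = rel_code {(x, y). y = f x}"

definition models_DNC :: "nat set set \<Rightarrow> (nat \<Rightarrow> nat) \<Rightarrow> bool" where
  "models_DNC S h \<longleftrightarrow> (\<forall>X\<in>S. \<exists>f. fun_code f \<in> S \<and> h_bounded h f \<and> dnc f X)"

text \<open>
  Since the functional with index \<open>0\<close> is the constant function \<open>0\<close>, a bound with
  \<open>h 0 = 0\<close> makes \<open>DNC\<^sub>h\<close> false outright. For every other order, \<open>DNC\<^sub>h\<close> is true.
\<close>

lemma models_DNC_imp_pos:
  assumes "turing_ideal S" "models_DNC S h"
  shows "0 < h 0"
proof -
  obtain X where "X \<in> S"
    using assms(1) by (auto simp: turing_ideal_def)
  then obtain f where "h_bounded h f" "dnc f X"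
    using assms(2) by (auto simp: models_DNC_def)
  then have f: "f 0 \<le> h 0" "Phi 0 X 0 \<noteq> Some (f 0)"
    by (simp_all add: h_bounded_def dnc_def)
  have "Phi 0 X 0 = Some 0"
    by (simp add: Phi_def decode.simps)
  then show ?thesis using f by (cases "h 0") auto
qed

lemma models_DNC_UNIV:
  assumes "is_order h" "0 < h 0"
  shows "models_DNC UNIV h"
proof -
  have "0 < h x" for x
    using assms monoD[of h 0 x] by (auto simp: is_order_def)
  then have "h_bounded h (\<lambda>e. if Phi e X e = Some 0 then 1 else 0) \<and>
      dnc (\<lambda>e. if Phi e X e = Some 0 then 1 else 0) X" for X
    by (auto simp: h_bounded_def dnc_def Suc_le_eq)
  then show ?thesis
    unfolding models_DNC_def by blast
qed


section \<open>Ramsey-type graph colouring\<close>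

text \<open>A graph is a pair of a vertex set and a symmetric irreflexive edge relation on it.\<close>

type_synonym ugraph = "nat set \<times> (nat \<times> nat) set"

definition is_graph :: "ugraph \<Rightarrow> bool" where
  "is_graph G \<longleftrightarrow> snd G \<subseteq> fst G \<times> fst G \<and> sym (snd G) \<and> irrefl (snd G)"

definition graph_in :: "ugraph \<Rightarrow> nat set set \<Rightarrow> bool" where
  "graph_in G S \<longleftrightarrow> fst G \<in> S \<and> rel_code (snd G) \<in> S"

definition subgraph :: "ugraph \<Rightarrow> ugraph \<Rightarrow> bool" where
  "subgraph G' G \<longleftrightarrow> is_graph G' \<and> fst G' \<subseteq> fst G \<and> snd G' \<subseteq> snd G"

definition induced :: "ugraph \<Rightarrow> nat set \<Rightarrow> ugraph" where
  "induced G W = (W, snd G \<inter> (W \<times> W))"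

definition coloring :: "nat \<Rightarrow> ugraph \<Rightarrow> (nat \<Rightarrow> nat) \<Rightarrow> bool" where
  "coloring k G c \<longleftrightarrow> (\<forall>v\<in>fst G. c v < k) \<and> (\<forall>(u, v)\<in>snd G. c u \<noteq> c v)"

definition locally_colorable :: "nat \<Rightarrow> ugraph \<Rightarrow> bool" where
  "locally_colorable k G \<longleftrightarrow>
     (\<forall>F. subgraph F G \<and> finite (fst F) \<longrightarrow> (\<exists>c. coloring k F c))"

definition homogeneous :: "nat \<Rightarrow> ugraph \<Rightarrow> nat set \<Rightarrow> bool" where
  "homogeneous k G H \<longleftrightarrow> H \<subseteq> fst G \<and>
     (\<forall>W. W \<subseteq> fst G \<and> finite W \<longrightarrow>
        (\<exists>c. coloring k (induced G W) c \<and> (\<forall>v\<in>W \<inter> H. c v = 0)))"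

text \<open>
  Finite sets and their colourings are coded by numbers, so in an \<open>\<omega>\<close>-model the notions
  above have their true meaning; only \<open>G\<close> and \<open>H\<close> range over the second-order part.
\<close>

definition models_RCOLOR :: "nat set set \<Rightarrow> nat \<Rightarrow> bool" where
  "models_RCOLOR S k \<longleftrightarrow>
     (\<forall>G. is_graph G \<and> infinite (fst G) \<and> locally_colorable k G \<and> graph_in G S \<longrightarrow>
        (\<exists>H\<in>S. infinite H \<and> homogeneous k G H))"

end

theory Submission
  imports Defs
begin

text \<open>
  The graph \<open>E\<close> is not computed but built by forcing, together with the functions
  \<open>f 0, f 1, \<dots>\<close> generating the ideal; \<open>f i\<close> is diagonally non-computable relative to the set
  computed by the program \<open>e\<close> from \<open>E, f 0, \<dots>, f (m - 1)\<close>, where \<open>i\<close> codes \<open>(m, e)\<close>. A condition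
  consists of a finite \<open>2\<close>-colourable graph, finitely many finite strings, and an open set of bad
  extensions which is small in the sense of bushy trees. Since only continuity of Turing functionals
  matters, no effectiveness of the forcing is needed.

  To keep a computed set \<open>H\<close> from being infinite and homogeneous, enumerate an element of \<open>H\<close> on
  every leaf of a bushy tree, then freeze the current graph and enumerate a second element among new
  vertices on every leaf of a further bushy tree. If one of the two searches fails, its target is
  declared bad and \<open>H\<close> is finite. Otherwise old and new vertices lie in different components, so for
  one of the two relative colourings the two elements get different colours on half of the leaves;
  two fresh vertices then connect everything according to this colouring.
\<close>

section \<open>Oracle computations\<close>

lemma finite_common_bound:
  assumes "finite I" "\<And>i. i \<in> I \<Longrightarrow> \<exists>b::nat. P i b" "\<And>i b c. P i b \<Longrightarrow> b \<le> c \<Longrightarrow> P i c"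
  shows "\<exists>b. \<forall>i\<in>I. P i b"
  using assms(1,2)
proof (induction I)
  case (insert i I)
  then obtain b c where "P i b" "\<forall>i\<in>I. P i c"
    by blast
  then have "\<forall>j\<in>insert i I. P j (max b c)"
    using assms(3) max.cobounded1 max.cobounded2 by blast
  then show ?case ..
qed simp

definition agree_below :: "nat \<Rightarrow> nat set \<Rightarrow> nat set \<Rightarrow> bool" where
  "agree_below b X Y \<longleftrightarrow> (\<forall>m<b. m \<in> Y \<longleftrightarrow> m \<in> X)"

lemma agree_below_mono: "agree_below c X Y \<Longrightarrow> b \<le> c \<Longrightarrow> agree_below b X Y"
  by (auto simp: agree_below_def)

text \<open>A halting computation consults only finitely many oracle bits. All that the forcing uses
  of programs is this finite use.\<close>

lemma eval_use:
  assumes "eval X p n = Some y"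
  shows "\<exists>b. \<forall>Y. agree_below b X Y \<longrightarrow> eval Y p n = Some y"
  using assms
proof (induction p arbitrary: n y)
  case POracle
  then show ?case by (intro exI[of _ "Suc n"]) (auto simp: agree_below_def)
next
  case (PPair p q)
  then obtain a b where ab: "eval X p n = Some a" "eval X q n = Some b" "y = prod_encode (a, b)"
    by (auto simp: bind_eq_Some_conv)
  obtain c d where "\<forall>Y. agree_below c X Y \<longrightarrow> eval Y p n = Some a"
      "\<forall>Y. agree_below d X Y \<longrightarrow> eval Y q n = Some b"
    using PPair.IH ab by meson
  then have "\<forall>Y. agree_below (max c d) X Y \<longrightarrow> eval Y (PPair p q) n = Some y"
    using ab agree_below_mono[of "max c d" X _ c] agree_below_mono[of "max c d" X _ d] by auto
  then show ?case ..
next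
  case (PComp p q)
  then obtain a where a: "eval X q n = Some a" "eval X p a = Some y"
    by (auto simp: bind_eq_Some_conv)
  obtain c d where "\<forall>Y. agree_below c X Y \<longrightarrow> eval Y q n = Some a"
      "\<forall>Y. agree_below d X Y \<longrightarrow> eval Y p a = Some y"
    using PComp.IH a by meson
  then have "\<forall>Y. agree_below (max c d) X Y \<longrightarrow> eval Y (PComp p q) n = Some y"
    using agree_below_mono[of "max c d" X _ c] agree_below_mono[of "max c d" X _ d] by auto
  then show ?case ..
next
  case (PRec p q)
  obtain a m where n: "prod_decode n = (a, m)"
    by fastforce
  define F where "F Z m = rec_nat (eval Z p a)
       (\<lambda>k r. Option.bind r (\<lambda>y. eval Z q (prod_encode (a, prod_encode (k, y))))) m" for Z m
  have "\<exists>b. \<forall>Y. agree_below b X Y \<longrightarrow> F Y m = Some y" if "F X m = Some y" for m y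
    using that
  proof (induction m arbitrary: y)
    case 0
    then show ?case using PRec.IH(1) by (simp add: F_def)
  next
    case (Suc m)
    then obtain z where z: "F X m = Some z" "eval X q (prod_encode (a, prod_encode (m, z))) = Some y"
      by (auto simp: F_def bind_eq_Some_conv)
    obtain c d where "\<forall>Y. agree_below c X Y \<longrightarrow> F Y m = Some z"
        "\<forall>Y. agree_below d X Y \<longrightarrow> eval Y q (prod_encode (a, prod_encode (m, z))) = Some y"
      using Suc.IH z PRec.IH(2) by meson
    moreover have "F Y (Suc m) = Option.bind (F Y m) (\<lambda>y. eval Y q (prod_encode (a, prod_encode (m, y))))" for Y
      by (simp add: F_def)
    ultimately have "\<forall>Y. agree_below (max c d) X Y \<longrightarrow> F Y (Suc m) = Some y"
      using agree_below_mono[of "max c d" X _ c] agree_below_mono[of "max c d" X _ d] by auto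
    then show ?case ..
  qed
  moreover have "eval Z (PRec p q) n = F Z m" for Z
    by (simp add: n F_def)
  ultimately show ?case
    using PRec.prems by metis
next
  case (PMu p)
  define G where "G Z k = eval Z p (prod_encode (n, k))" for Z k
  have PMu_eq: "eval Z (PMu p) n = (if \<exists>m. G Z m = Some 0 \<and> (\<forall>k<m. G Z k \<noteq> None)
      then Some (LEAST m. G Z m = Some 0) else None)" for Z
    by (simp only: eval.simps G_def)
  \<comment> \<open>The least-zero clause becomes a conjunction of convergent computations, one for
    each argument up to \<open>y\<close>, so only finitely many uses have to be bounded.\<close>
  have mu: "eval Z (PMu p) n = Some y \<longleftrightarrow> G Z y = Some 0 \<and> (\<forall>k<y. \<exists>z. G Z k = Some (Suc z))" for Z
  proof
    assume "eval Z (PMu p) n = Some y"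
    then obtain m where m: "G Z m = Some 0" "\<forall>k<m. G Z k \<noteq> None" and y: "y = (LEAST m. G Z m = Some 0)"
      unfolding PMu_eq by (metis option.distinct(1) option.inject)
    have "G Z y = Some 0" "y \<le> m"
      unfolding y using m by (auto intro: LeastI Least_le)
    moreover have "\<exists>z. G Z k = Some (Suc z)" if "k < y" for k
    proof -
      have "G Z k \<noteq> Some 0"
        using that not_less_Least unfolding y by blast
      moreover have "G Z k \<noteq> None"
        using m that \<open>y \<le> m\<close> by simp
      ultimately show ?thesis
        by (metis not0_implies_Suc option.exhaust)
    qed
    ultimately show "G Z y = Some 0 \<and> (\<forall>k<y. \<exists>z. G Z k = Some (Suc z))"
      by blast
  next
    assume R: "G Z y = Some 0 \<and> (\<forall>k<y. \<exists>z. G Z k = Some (Suc z))"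
    then have "\<forall>k<y. G Z k \<noteq> None"
      by auto
    moreover have "(LEAST m. G Z m = Some 0) = y"
    proof (rule Least_equality)
      show "y \<le> k" if "G Z k = Some 0" for k
        using R that by (metis Suc_neq_Zero linorder_not_le option.inject)
    qed (use R in blast)
    ultimately show "eval Z (PMu p) n = Some y"
      unfolding PMu_eq using R by (metis (no_types, lifting))
  qed
  have X: "G X y = Some 0" "\<forall>k<y. \<exists>z. G X k = Some (Suc z)"
    using PMu.prems mu by auto
  have "\<exists>b. \<forall>k\<in>{..y}. \<forall>Y. agree_below b X Y \<longrightarrow> G Y k = G X k"
  proof (rule finite_common_bound)
    fix k assume "k \<in> {..y}"
    then obtain z where "G X k = Some z"
      using X by (cases "k = y") (simp, metis atMost_iff le_neq_implies_less)
    then show "\<exists>b. \<forall>Y. agree_below b X Y \<longrightarrow> G Y k = G X k"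
      using PMu.IH[of "prod_encode (n, k)" z] unfolding G_def by simp
  qed (use agree_below_mono in blast)+
  then obtain b where "\<forall>k\<in>{..y}. \<forall>Y. agree_below b X Y \<longrightarrow> G Y k = G X k" ..
  then have "\<forall>Y. agree_below b X Y \<longrightarrow> eval Y (PMu p) n = Some y"
    unfolding mu using X by simp
  then show ?case ..
qed auto

section \<open>Substituting a program for the oracle; Turing reducibility\<close>

primrec oracle_subst :: "prog \<Rightarrow> prog \<Rightarrow> prog" where
  "oracle_subst r PZero = PZero"
| "oracle_subst r PSucc = PSucc"
| "oracle_subst r PFst = PFst"
| "oracle_subst r PSnd = PSnd"
| "oracle_subst r POracle = r"
| "oracle_subst r (PPair p q) = PPair (oracle_subst r p) (oracle_subst r q)"
| "oracle_subst r (PComp p q) = PComp (oracle_subst r p) (oracle_subst r q)"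
| "oracle_subst r (PRec p q) = PRec (oracle_subst r p) (oracle_subst r q)"
| "oracle_subst r (PMu p) = PMu (oracle_subst r p)"

definition decides :: "nat set \<Rightarrow> prog \<Rightarrow> nat set \<Rightarrow> bool" where
  "decides B p A \<longleftrightarrow> (\<forall>n. eval B p n = Some (if n \<in> A then 1 else 0))"

lemma turing_le_decode: "turing_le A B \<longleftrightarrow> (\<exists>e. decides B (decode e) A)"
  unfolding turing_le_def Phi_def decides_def ..

lemma turing_le_iff: "turing_le A B \<longleftrightarrow> (\<exists>p. decides B p A)"
  unfolding turing_le_def Phi_def decides_def using surj_decode by (metis surjD)

lemma eval_oracle_subst:
  assumes "decides B r A"
  shows "eval B (oracle_subst r p) = eval A p"
proof (induction p)
  case POracle
  then show ?case using assms by (auto simp: decides_def)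
next
  case (PMu p)
  show ?case by (simp only: eval.simps oracle_subst.simps PMu)
qed simp_all

lemma turing_le_refl: "turing_le A A"
  unfolding turing_le_iff decides_def by (rule exI[of _ POracle]) simp

lemma turing_le_trans: "turing_le A B \<Longrightarrow> turing_le B C \<Longrightarrow> turing_le A C"
  unfolding turing_le_iff by (metis decides_def eval_oracle_subst)

lemma turing_le_UNIV: "turing_le UNIV B"
  unfolding turing_le_iff decides_def by (rule exI[of _ "PComp PSucc PZero"]) simp

section \<open>Explicit programs for the Turing join\<close>

definition p_id :: prog where
  "p_id = PPair PFst PSnd"

lemma eval_p_id [simp]: "eval X p_id n = Some n"
  by (simp add: p_id_def)

definition p_iterate :: "prog \<Rightarrow> prog" where
  "p_iterate q = PComp (PRec PZero (PComp q (PComp PSnd PSnd))) (PPair PZero p_id)"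

lemma eval_p_iterate:
  assumes "f 0 = 0" "\<And>k. eval X q (f k) = Some (f (Suc k))"
  shows "eval X (p_iterate q) n = Some (f n)"
proof -
  have "rec_nat (Some 0) (\<lambda>k r. Option.bind r (\<lambda>y. eval X q y)) n = Some (f n)"
    by (induction n) (simp_all add: assms)
  then show ?thesis
    by (simp add: p_iterate_def)
qed

definition p_double :: prog where
  "p_double = p_iterate (PComp PSucc PSucc)"

lemma eval_p_double [simp]: "eval X p_double n = Some (2 * n)"
  unfolding p_double_def by (rule eval_p_iterate) simp_all

definition p_if :: "prog \<Rightarrow> prog \<Rightarrow> prog" where
  "p_if p q = PRec p (PComp q PFst)"

text \<open>\<open>PRec\<close> evaluates its base \<open>p\<close> even when the bit is 1, so
  convergence of \<open>p\<close> at \<open>a\<close> matters for the second equation as well; there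
  \<open>PFst\<close> recovers \<open>a\<close> and the value of \<open>p\<close> is
  discarded.\<close>

lemma eval_p_if:
  assumes "eval X p a \<noteq> None"
  shows "eval X (p_if p q) (prod_encode (a, 0)) = eval X p a"
    "eval X (p_if p q) (prod_encode (a, Suc 0)) = eval X q a"
  using assms by (auto simp: p_if_def)

text \<open>Division by two with remainder as an iterated step: the parity bit is set, or it is
  cleared and the quotient grows. The iteration may start at 0 because 0 codes the pair
  \<open>(0, 0)\<close>.\<close>

definition p_half_parity :: prog where
  "p_half_parity = p_iterate
     (p_if (PPair p_id (PComp PSucc PZero)) (PPair PSucc PZero))"

lemma eval_p_half_parity [simp]:
  "eval X p_half_parity n = Some (prod_encode (n div 2, n mod 2))"
  unfolding p_half_parity_def
proof (rule eval_p_iterate)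
  show "prod_encode (0 div 2, 0 mod 2) = 0"
    by (simp add: prod_encode_def)
  show "eval X (p_if (PPair p_id (PComp PSucc PZero)) (PPair PSucc PZero))
      (prod_encode (k div 2, k mod 2)) = Some (prod_encode (Suc k div 2, Suc k mod 2))" for k
  proof (cases "even k")
    case True
    then have "k mod 2 = 0" "Suc k div 2 = k div 2" "Suc k mod 2 = Suc 0"
      by (auto simp: even_iff_mod_2_eq_zero mod_Suc)
    then show ?thesis by (simp add: eval_p_if)
  next
    case False
    then have "k mod 2 = Suc 0" "Suc k div 2 = Suc (k div 2)" "Suc k mod 2 = 0"
      by (auto simp: odd_iff_mod_2_eq_one mod_Suc)
    then show ?thesis by (simp add: eval_p_if)
  qed
qed

lemma turing_le_join1: "turing_le A (turing_join A B)"
  unfolding turing_le_iff decides_def turing_join_def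
  by (rule exI[of _ "PComp POracle p_double"]) (auto, presburger)

lemma turing_le_join2: "turing_le B (turing_join A B)"
  unfolding turing_le_iff decides_def turing_join_def
  by (rule exI[of _ "PComp POracle (PComp PSucc p_double)"]) (auto, presburger)

lemma mem_turing_join:
  "m \<in> turing_join A B \<longleftrightarrow> (if even m then m div 2 \<in> A else m div 2 \<in> B)"
  by (auto simp: turing_join_def elim!: evenE oddE; presburger)

lemma turing_join_le:
  assumes "turing_le A C" "turing_le B C"
  shows "turing_le (turing_join A B) C"
proof -
  obtain p q where p: "decides C p A" and q: "decides C q B"
    using assms turing_le_iff by blast
  have "decides C (PComp (p_if p q) p_half_parity) (turing_join A B)"
    unfolding decides_def
  proof
    fix n
    show "eval C (PComp (p_if p q) p_half_parity) n = Some (if n \<in> turing_join A B then 1 else 0)"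
    proof (cases "even n")
      case True
      then have "n mod 2 = 0" by presburger
      then show ?thesis
        using True p by (simp add: eval_p_if decides_def mem_turing_join)
    next
      case False
      then have "n mod 2 = Suc 0" by presburger
      then show ?thesis
        using False p q by (simp add: eval_p_if decides_def mem_turing_join)
    qed
  qed
  then show ?thesis
    unfolding turing_le_iff by blast
qed

section \<open>Bushy trees over finite graphs\<close>

text \<open>Colours are booleans, so a colouring can be flipped on a union of components by
  exclusive or.\<close>

definition proper :: "(nat \<times> nat) set \<Rightarrow> (nat \<Rightarrow> bool) \<Rightarrow> bool" where
  "proper E c \<longleftrightarrow> (\<forall>(u, v)\<in>E. c u \<noteq> c v)"

text \<open>A pair \<open>(n, E)\<close> stands for a graph with vertex set \<open>{..<n}\<close>.\<close>

type_synonym fgraph = "nat \<times> (nat \<times> nat) set"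

definition is_fgraph :: "fgraph \<Rightarrow> bool" where
  "is_fgraph g \<longleftrightarrow> snd g \<subseteq> {..<fst g} \<times> {..<fst g} \<and> sym (snd g) \<and> (\<exists>c. proper (snd g) c)"

text \<open>The vertices below \<open>l\<close> are frozen: an extension gives them no new neighbours.\<close>

definition gext :: "nat \<Rightarrow> fgraph \<Rightarrow> fgraph \<Rightarrow> bool" where
  "gext l g g' \<longleftrightarrow> is_fgraph g' \<and> fst g \<le> fst g' \<and>
     snd g' \<inter> ({..<fst g} \<times> {..<fst g}) = snd g \<and>
     (\<forall>a b. (a, b) \<in> snd g' \<and> a < l \<longrightarrow> (a, b) \<in> snd g)"

lemma gext_refl: "is_fgraph g \<Longrightarrow> gext l g g"
  by (auto simp: gext_def is_fgraph_def)

lemma gext_trans: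
  assumes "gext l g g'" "gext l g' g''"
  shows "gext l g g''"
proof -
  have le: "fst g \<le> fst g'" "fst g' \<le> fst g''"
    using assms by (auto simp: gext_def)
  have 1: "(a, b) \<in> snd g' \<longleftrightarrow> (a, b) \<in> snd g''" if "a < fst g'" "b < fst g'" for a b
    using assms(2) that unfolding gext_def by blast
  have 2: "(a, b) \<in> snd g' \<and> a < fst g \<and> b < fst g \<longleftrightarrow> (a, b) \<in> snd g" for a b
    using assms(1) unfolding gext_def by blast
  have "(a, b) \<in> snd g'' \<inter> ({..<fst g} \<times> {..<fst g}) \<longleftrightarrow> (a, b) \<in> snd g" for a b
    using 1[of a b] 2[of a b] le by auto
  then have "snd g'' \<inter> ({..<fst g} \<times> {..<fst g}) = snd g"
    by (intro subset_antisym subrelI) blast+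
  moreover have "(a, b) \<in> snd g" if "(a, b) \<in> snd g''" "a < l" for a b
    using assms that unfolding gext_def by blast
  ultimately show ?thesis
    using assms le unfolding gext_def by simp
qed

lemma gext_mono: "gext l' g g' \<Longrightarrow> l \<le> l' \<Longrightarrow> gext l g g'"
  by (auto simp: gext_def)

lemma gext_fgraph: "gext l g g' \<Longrightarrow> is_fgraph g'"
  by (simp add: gext_def)

lemma gext_le: "gext l g g' \<Longrightarrow> fst g \<le> fst g'"
  by (simp add: gext_def)

lemma gext_sub: "gext l g g' \<Longrightarrow> snd g \<subseteq> snd g'"
  by (auto simp: gext_def)

section \<open>Bushy trees of \<open>h\<close>-bounded strings\<close>

locale order_bound =
  fixes h :: "nat \<Rightarrow> nat"
  assumes is_order: "is_order h" and pos: "0 < h 0"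
begin

lemma h_mono: "i \<le> j \<Longrightarrow> h i \<le> h j"
  using is_order by (auto simp: is_order_def dest: monoD)

text \<open>Existence of a finite tree rooted at the given string, whose inner nodes have at least
  \<open>k\<close> children and whose leaves lie in \<open>C\<close>; rule induction replaces
  induction on trees. For \<open>k = 0\<close> the empty \<open>K\<close> would make every string
  big, so conditions ask for positive values.\<close>

inductive big :: "nat \<Rightarrow> (nat list \<Rightarrow> bool) \<Rightarrow> nat list \<Rightarrow> bool" for k C where
  leaf: "C \<tau> \<Longrightarrow> big k C \<tau>"
| branch: "K \<subseteq> {..h (length \<tau>)} \<Longrightarrow> k \<le> card K \<Longrightarrow> (\<And>a. a \<in> K \<Longrightarrow> big k C (\<tau> @ [a])) \<Longrightarrow> big k C \<tau>"

definition sext :: "nat list \<Rightarrow> nat list \<Rightarrow> bool" where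
  "sext \<sigma> \<tau> \<longleftrightarrow> (\<exists>w. \<tau> = \<sigma> @ w \<and> (\<forall>d<length w. w ! d \<le> h (length \<sigma> + d)))"

lemma sext_refl [simp]: "sext \<sigma> \<sigma>"
  by (auto simp: sext_def)

lemma sext_trans:
  assumes "sext \<sigma> \<tau>" "sext \<tau> \<rho>"
  shows "sext \<sigma> \<rho>"
proof -
  obtain w where w: "\<tau> = \<sigma> @ w" "\<forall>d<length w. w ! d \<le> h (length \<sigma> + d)"
    using assms(1) by (auto simp: sext_def)
  obtain w' where w': "\<rho> = \<tau> @ w'" "\<forall>d<length w'. w' ! d \<le> h (length \<tau> + d)"
    using assms(2) by (auto simp: sext_def)
  have "(w @ w') ! d \<le> h (length \<sigma> + d)" if "d < length (w @ w')" for d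
  proof (cases "d < length w")
    case True
    then show ?thesis using w by (simp add: nth_append)
  next
    case False
    then have "d - length w < length w'" "length \<tau> + (d - length w) = length \<sigma> + d"
      using that w by auto
    then show ?thesis using w'(2) False by (metis nth_append)
  qed
  then show ?thesis
    using w w' by (auto simp: sext_def)
qed

lemma sext_snoc: "a \<le> h (length \<sigma>) \<Longrightarrow> sext \<sigma> (\<sigma> @ [a])"
  by (auto simp: sext_def)

lemma big_mono:
  assumes "big k C \<sigma>" "\<And>\<tau>. sext \<sigma> \<tau> \<Longrightarrow> C \<tau> \<Longrightarrow> D \<tau>"
  shows "big k D \<sigma>"
  using assms
proof induction
  case (leaf \<tau>)
  then show ?case by (auto intro: big.leaf)
next
  case (branch K \<tau>)
  show ?case
  proof (rule big.branch)
    show "big k D (\<tau> @ [a])" if "a \<in> K" for a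
      using that branch.hyps(1) branch.IH branch.prems sext_snoc sext_trans
      by (metis atMost_iff subsetD)
  qed (use branch in auto)
qed

text \<open>Pigeonhole from the leaves upwards: with fewer than \<open>k\<close> children big for
  \<open>C\<close> and fewer than \<open>m\<close> big for \<open>D\<close>, a node would have at
  most \<open>k + m - 2\<close> children.\<close>

lemma big_split:
  assumes "big (k + m - 1) (\<lambda>\<tau>. C \<tau> \<or> D \<tau>) \<sigma>" "0 < k" "0 < m"
  shows "big k C \<sigma> \<or> big m D \<sigma>"
  using assms(1)
proof induction
  case (leaf \<tau>)
  then show ?case by (auto intro: big.leaf)
next
  case (branch K \<tau>)
  let ?K1 = "{a \<in> K. big k C (\<tau> @ [a])}" and ?K2 = "{a \<in> K. big m D (\<tau> @ [a])}"
  have "?K1 \<union> ?K2 = K"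
    using branch.IH by auto
  then have "card K \<le> card ?K1 + card ?K2"
    using card_Un_le[of ?K1 ?K2] by argo
  then have "k \<le> card ?K1 \<or> m \<le> card ?K2"
    using branch.hyps(2) assms by linarith
  then show ?case
  proof
    assume "k \<le> card ?K1"
    then have "big k C \<tau>"
      using branch.hyps(1) by - (rule big.branch[of ?K1], auto)
    then show ?thesis ..
  next
    assume "m \<le> card ?K2"
    then have "big m D \<tau>"
      using branch.hyps(1) by - (rule big.branch[of ?K2], auto)
    then show ?thesis ..
  qed
qed

text \<open>The full \<open>h\<close>-bounded tree serves; monotonicity of \<open>h\<close>
  preserves the assumed branching at longer strings.\<close>

lemma big_length:
  assumes "k \<le> h (length \<sigma>) + 1"
  shows "big k (\<lambda>\<tau>. L \<le> length \<tau>) \<sigma>"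
  using assms
proof (induction "L - length \<sigma>" arbitrary: \<sigma>)
  case 0
  then show ?case by (auto intro: big.leaf)
next
  case (Suc n)
  show ?case
  proof (rule big.branch[of "{..h (length \<sigma>)}"])
    show "big k (\<lambda>\<tau>. L \<le> length \<tau>) (\<sigma> @ [a])" for a
      using Suc.hyps(2) Suc.prems h_mono[of "length \<sigma>" "Suc (length \<sigma>)"]
      by (intro Suc.hyps(1)) auto
  qed (use Suc in auto)
qed

text \<open>At each argument only one value is forbidden, so two children cannot both turn bad.\<close>

lemma diagonal_not_big:
  assumes "\<And>d a b. F d a \<Longrightarrow> F d b \<Longrightarrow> a = b"
    and "big 2 (\<lambda>\<tau>. \<exists>d<length \<tau>. F d (\<tau> ! d)) \<sigma>"
  shows "\<exists>d<length \<sigma>. F d (\<sigma> ! d)"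
  using assms(2)
proof induction
  case (branch K \<tau>)
  obtain T where T: "T \<subseteq> K" "card T = 2"
    by (rule obtain_subset_with_card_n[OF branch.hyps(2)]) (rule that)
  obtain a b where "T = {a, b}" "a \<noteq> b"
    using T(2) unfolding card_2_iff by blast
  then have ab: "a \<in> K" "b \<in> K" "a \<noteq> b"
    using T(1) by auto
  have old: "(\<exists>d<length \<tau>. F d (\<tau> ! d)) \<or> F (length \<tau>) x" if "x \<in> K" for x
    using branch.IH[OF that] by (auto simp: less_Suc_eq nth_append)
  show ?case
  proof (rule ccontr)
    assume "\<not> ?case"
    then have "F (length \<tau>) a" "F (length \<tau>) b"
      using old ab by blast+
    then show False
      using assms(1) ab(3) by blast
  qed
qed

section \<open>Nested trees in several coordinates above an extension of the graph\<close>

definition qext :: "nat \<Rightarrow> (nat \<Rightarrow> nat list) \<Rightarrow> (nat \<Rightarrow> nat list) \<Rightarrow> bool" where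
  "qext N q r \<longleftrightarrow> (\<forall>i. sext (q i) (r i)) \<and> (\<forall>i\<ge>N. r i = q i)"

lemma qext_refl [simp]: "qext N q q"
  by (simp add: qext_def)

lemma qext_trans: "qext N q r \<Longrightarrow> qext N r s \<Longrightarrow> qext N q s"
  by (auto simp: qext_def intro: sext_trans)

type_synonym cpred = "fgraph \<Rightarrow> (nat \<Rightarrow> nat list) \<Rightarrow> bool"

text \<open>Outermost an extension of the graph, then a tree for coordinate \<open>0\<close>, above each of its leaves
  a tree for coordinate \<open>1\<close>, and so on; the roots are the strings \<open>q i\<close>.\<close>

primrec nbig :: "nat \<Rightarrow> (nat \<Rightarrow> nat) \<Rightarrow> nat \<Rightarrow> cpred \<Rightarrow> cpred" where
  "nbig l k 0 A g q \<longleftrightarrow> (\<exists>g'. gext l g g' \<and> A g' q)"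
| "nbig l k (Suc i) A g q \<longleftrightarrow>
     nbig l k i (\<lambda>g' r. big (k i) (\<lambda>\<tau>. A g' (r(i := \<tau>))) (r i)) g q"

definition upc :: "cpred \<Rightarrow> bool" where
  "upc A \<longleftrightarrow> (\<forall>g q g' r. A g q \<and> gext 0 g g' \<and> (\<forall>i. sext (q i) (r i)) \<longrightarrow> A g' r)"

lemma upcD: "upc A \<Longrightarrow> A g q \<Longrightarrow> gext l g g' \<Longrightarrow> qext N q r \<Longrightarrow> A g' r"
  unfolding upc_def qext_def by (meson gext_mono le0)

lemma nbig_mono:
  assumes "nbig l k N A g q"
    and "\<And>g' r. gext l g g' \<Longrightarrow> qext N q r \<Longrightarrow> A g' r \<Longrightarrow> B g' r"
  shows "nbig l k N B g q"
  using assms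
proof (induction N arbitrary: A B)
  case 0
  then obtain g' where "gext l g g'" "A g' q"
    by auto
  then show ?case using 0(2)[of g' q] unfolding nbig.simps by (blast intro: qext_refl)
next
  case (Suc i)
  show ?case
    unfolding nbig.simps
  proof (rule Suc.IH[OF Suc.prems(1)[unfolded nbig.simps]])
    fix g' r
    assume g': "gext l g g'" and r: "qext i q r"
      and big: "big (k i) (\<lambda>\<tau>. A g' (r(i := \<tau>))) (r i)"
    show "big (k i) (\<lambda>\<tau>. B g' (r(i := \<tau>))) (r i)"
      using big
    proof (rule big_mono)
      fix \<tau> assume "sext (r i) \<tau>" "A g' (r(i := \<tau>))"
      moreover have "qext (Suc i) q (r(i := \<tau>))"
        using r \<open>sext (r i) \<tau>\<close> by (auto simp: qext_def)
      ultimately show "B g' (r(i := \<tau>))"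
        using Suc.prems(2) g' by blast
    qed
  qed
qed

lemma nbig_gext: "nbig l k N A g' q \<Longrightarrow> gext l g g' \<Longrightarrow> nbig l k N A g q"
  by (induction N arbitrary: A) (auto intro: gext_trans)

lemma nbig_lock: "nbig l' k N A g q \<Longrightarrow> l \<le> l' \<Longrightarrow> nbig l k N A g q"
  by (induction N arbitrary: A) (auto intro: gext_mono)

lemma nbig_here: "A g q \<Longrightarrow> is_fgraph g \<Longrightarrow> nbig l k N A g q"
proof (induction N arbitrary: A)
  case 0
  then show ?case unfolding nbig.simps using gext_refl by blast
next
  case (Suc i)
  have "big (k i) (\<lambda>\<tau>. A g (q(i := \<tau>))) (q i)"
    by (rule big.leaf) (simp add: Suc.prems)
  then show ?case
    unfolding nbig.simps using Suc.prems(2) by (rule Suc.IH)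
qed

lemma nbig_upd:
  "N \<le> i \<Longrightarrow> nbig l k N A g (q(i := \<tau>)) \<longleftrightarrow> nbig l k N (\<lambda>g r. A g (r(i := \<tau>))) g q"
  by (induction N arbitrary: A) (simp_all add: fun_upd_twist)

text \<open>\<open>big_split\<close> treats the innermost coordinate and leaves a disjunction for
  the coordinates further out. The graph, being a single choice, falls on one side at once.\<close>

lemma nbig_split:
  assumes "nbig l (\<lambda>i. k i + m i - 1) N (\<lambda>g r. A g r \<or> B g r) g q"
    and "\<And>i. 0 < k i" "\<And>i. 0 < m i"
  shows "nbig l k N A g q \<or> nbig l m N B g q"
  using assms(1)
proof (induction N arbitrary: A B)
  case 0
  then show ?case by auto
next
  case (Suc i)
  have "nbig l (\<lambda>i. k i + m i - 1) i
      (\<lambda>g r. big (k i) (\<lambda>\<tau>. A g (r(i := \<tau>))) (r i) \<or> big (m i) (\<lambda>\<tau>. B g (r(i := \<tau>))) (r i)) g q"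
    using Suc.prems unfolding nbig.simps
    by (rule nbig_mono) (intro big_split assms)
  then show ?case
    unfolding nbig.simps by (rule Suc.IH)
qed

text \<open>The trees of the different coordinates are nested, so bigness of \<open>B\<close> above a condition
  need not persist to its extensions; this is why the hypothesis speaks about all of the
  up-closed set \<open>A\<close> and not just about the leaves of one tree.\<close>

lemma nbig_trans:
  assumes "upc A" "upc B" "nbig l k N A g q"
    and "\<And>g' r. gext l g g' \<Longrightarrow> qext N q r \<Longrightarrow> A g' r \<Longrightarrow> nbig l k N B g' r"
  shows "nbig l k N B g q"
  using assms
proof (induction N arbitrary: A B g q)
  case 0
  then obtain g' where g': "gext l g g'" "A g' q"
    by auto
  then have "nbig l k 0 B g' q"
    using 0(4) by simp
  then show ?case
    unfolding nbig.simps using g'(1) gext_trans by blast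
next
  case (Suc i)
  \<comment> \<open>Fixing the root \<open>\<tau>\<close> of the innermost tree, instead of reading
    it off \<open>r i\<close>, gives a predicate on the outer coordinates that suits induction along
    that tree.\<close>
  define over where "over C \<tau> g' r = big (k i) (\<lambda>\<rho>. C g' (r(i := \<rho>))) \<tau>"
    for C :: cpred and \<tau> g' r
  have upc_over: "upc (over C \<tau>)" if "upc C" for C \<tau>
    unfolding upc_def over_def
  proof (intro allI impI, elim conjE)
    fix g1 q1 g2 r2
    assume b: "big (k i) (\<lambda>\<rho>. C g1 (q1(i := \<rho>))) \<tau>" and g: "gext 0 g1 g2"
      and s: "\<forall>i. sext (q1 i) (r2 i)"
    show "big (k i) (\<lambda>\<rho>. C g2 (r2(i := \<rho>))) \<tau>"
      using b
    proof (rule big_mono)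
      fix \<rho> assume "C g1 (q1(i := \<rho>))"
      moreover have "\<forall>j. sext ((q1(i := \<rho>)) j) ((r2(i := \<rho>)) j)"
        using s by simp
      ultimately show "C g2 (r2(i := \<rho>))"
        using that g unfolding upc_def by blast
    qed
  qed
  have fix_start: "nbig l k (Suc i) C g' r \<longleftrightarrow> nbig l k i (over C (r i)) g' r" for C g' r
    unfolding nbig.simps over_def
    by (rule iffI; erule nbig_mono) (auto simp: qext_def)
  \<comment> \<open>Finitely many up-closed sets, each big above all extensions, are jointly big:
    they are entered one after the other, and up-closure keeps what was already gained.\<close>
  have conj: "nbig l k i (\<lambda>g r. \<forall>a\<in>K. C a g r) g2 r2"
    if "finite K" "\<And>a. a \<in> K \<Longrightarrow> upc (C a)" "gext l g1 g2" "qext i r1 r2"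
      "\<And>a g2 r2. a \<in> K \<Longrightarrow> gext l g1 g2 \<Longrightarrow> qext i r1 r2 \<Longrightarrow> nbig l k i (C a) g2 r2"
    for K :: "nat set" and C g1 g2 r1 r2
    using that
  proof (induction K)
    case empty
    then show ?case by (auto intro: nbig_here gext_fgraph)
  next
    case (insert a K)
    show ?case
    proof (rule Suc.IH[of "\<lambda>g r. \<forall>a\<in>K. C a g r"])
      show "upc (\<lambda>g r. \<forall>a\<in>K. C a g r)" "upc (\<lambda>g r. \<forall>a\<in>insert a K. C a g r)"
        using insert.prems(1) unfolding upc_def by blast+
      show "nbig l k i (\<lambda>g r. \<forall>a\<in>K. C a g r) g2 r2"
        using insert by auto
      fix g3 r3 assume 3: "gext l g2 g3" "qext i r2 r3" "\<forall>a\<in>K. C a g3 r3"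
      have "nbig l k i (C a) g3 r3"
        by (rule insert.prems(4)[OF insertI1 gext_trans[OF insert.prems(2) 3(1)]
              qext_trans[OF insert.prems(3) 3(2)]])
      then show "nbig l k i (\<lambda>g r. \<forall>a\<in>insert a K. C a g r) g3 r3"
      proof (rule nbig_mono)
        fix g4 r4 assume 4: "gext l g3 g4" "qext i r3 r4" "C a g4 r4"
        show "\<forall>a\<in>insert a K. C a g4 r4"
          using 4(3) 3(3) upcD[OF insert.prems(1) _ 4(1,2)] by blast
      qed
    qed
  qed
  have "nbig l k i (over B (q i)) g q"
  proof (rule Suc.IH[of "over A (q i)"])
    show "upc (over A (q i))" "upc (over B (q i))"
      using Suc.prems upc_over by auto
    show "nbig l k i (over A (q i)) g q"
      using Suc.prems(3) fix_start by blast
    fix g' r assume g': "gext l g g'" and r: "qext i q r" and "over A (q i) g' r"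
    \<comment> \<open>Induction along the innermost tree for \<open>A\<close>: at a leaf the
      hypothesis on \<open>A\<close> applies, and at a branching node \<open>conj\<close> merges
      what was obtained for the children.\<close>
    have "nbig l k i (over B \<tau>) g2 r2"
      if "big (k i) (\<lambda>\<rho>. A g' (r(i := \<rho>))) \<tau>" "sext (q i) \<tau>" "gext l g' g2" "qext i r r2"
      for \<tau> g2 r2
      using that
    proof (induction arbitrary: g2 r2)
      case (leaf \<tau>)
      have "qext (Suc i) (r(i := \<tau>)) (r2(i := \<tau>))"
        using leaf by (auto simp: qext_def)
      then have A: "A g2 (r2(i := \<tau>))"
        using leaf Suc.prems(1) upcD by blast
      have qi: "r2 i = q i"
        using r leaf by (auto simp: qext_def)
      have "qext i q r2"
        using r leaf qext_trans by blast
      then have "qext (Suc i) q (r2(i := \<tau>))"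
        using leaf(2) by (auto simp: qext_def)
      then have "nbig l k (Suc i) B g2 (r2(i := \<tau>))"
        using A leaf g' gext_trans Suc.prems(4) by blast
      then show ?case
        unfolding fix_start using nbig_upd[of i i l k "over B \<tau>" g2 r2 \<tau>]
        by (simp add: over_def)
    next
      case (branch K \<tau>)
      have "nbig l k i (\<lambda>g r. \<forall>a\<in>K. over B (\<tau> @ [a]) g r) g2 r2"
      proof (rule conj)
        show "finite K"
          using branch.hyps(1) finite_subset by blast
        show "gext l g' g2" "qext i r r2"
          using branch.prems by auto
        show "upc (over B (\<tau> @ [a]))" for a
          using upc_over Suc.prems by auto
        show "nbig l k i (over B (\<tau> @ [a])) g2 r2"
          if "a \<in> K" "gext l g' g2" "qext i r r2" for a g2 r2
        proof (rule branch.IH[OF that(1) _ that(2,3)])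
          have "a \<le> h (length \<tau>)"
            using that branch.hyps(1) by auto
          then show "sext (q i) (\<tau> @ [a])"
            using branch.prems(1) sext_snoc sext_trans by blast
        qed
      qed
      then show ?case
      proof (rule nbig_mono)
        fix g3 r3 assume "\<forall>a\<in>K. over B (\<tau> @ [a]) g3 r3"
        then show "over B \<tau> g3 r3"
          unfolding over_def using branch.hyps by (blast intro: big.branch)
      qed
    qed
    then show "nbig l k i (over B (q i)) g' r"
      using \<open>over A (q i) g' r\<close> gext_refl gext_fgraph[OF g'] unfolding over_def by simp
  qed
  then show ?case
    using fix_start by blast
qed

text \<open>Contrapositive of \<open>nbig_trans\<close>, and the usual way to extend a condition: a
  big set is entered while the bad set stays small.\<close>

lemma nbig_pick:
  assumes "upc A" "upc B" "nbig l k N A g q" "\<not> nbig l k N B g q"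
  obtains g' r where "gext l g g'" "qext N q r" "A g' r" "\<not> nbig l k N B g' r"
  using nbig_trans[OF assms(1-3)] assms(4) by blast

lemma nbig_length:
  assumes "is_fgraph g" "\<And>i. i < N \<Longrightarrow> k i \<le> h (length (q i)) + 1"
  shows "nbig l k N (\<lambda>g' r. L \<le> fst g' \<and> (\<forall>i<N. L \<le> length (r i))) g q"
  using assms(2)
proof (induction N)
  case 0
  \<comment> \<open>Isolated vertices make the graph as large as desired.\<close>
  have "gext l g (fst g + L, snd g)"
    using assms(1) by (auto simp: gext_def is_fgraph_def)
  then show ?case by (auto intro!: exI[of _ "fst g + L"])
next
  case (Suc i)
  then have "nbig l k i (\<lambda>g' r. L \<le> fst g' \<and> (\<forall>j<i. L \<le> length (r j))) g q"
    by (intro Suc.IH) simp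
  then show ?case
    unfolding nbig.simps
  proof (rule nbig_mono)
    fix g' r
    assume r: "qext i q r" and len: "L \<le> fst g' \<and> (\<forall>j<i. L \<le> length (r j))"
    have "r i = q i"
      using r by (simp add: qext_def)
    then have "big (k i) (\<lambda>\<tau>. L \<le> length \<tau>) (r i)"
      using Suc.prems by (simp add: big_length)
    then show "big (k i) (\<lambda>\<tau>. L \<le> fst g' \<and> (\<forall>j<Suc i. L \<le> length ((r(i := \<tau>)) j))) (r i)"
      by (rule big_mono) (use len in \<open>auto simp: less_Suc_eq\<close>)
  qed
qed

end

section \<open>Forcing conditions\<close>

text \<open>The new vertices \<open>p\<close> and \<open>p + 1\<close> are adjacent;
  \<open>p\<close> is joined to the class coloured \<open>True\<close> and \<open>p + 1\<close> to
  the other class. With two colours only, each class must take the colour of the new vertex it is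
  not joined to. Vertices below \<open>n\<close> get no edges and so stay frozen.\<close>

lemma link_colour_classes:
  assumes "is_fgraph g" "proper (snd g) c" "n \<le> fst g"
  obtains g' where "gext n g g'"
    "\<forall>u v c'. n \<le> u \<and> u < fst g \<and> n \<le> v \<and> v < fst g \<and> c u \<noteq> c v \<and> proper (snd g') c'
      \<longrightarrow> c' u \<noteq> c' v"
proof -
  define p where "p = fst g"
  define S where "S = {(p, x) | x. n \<le> x \<and> x < p \<and> c x} \<union>
    {(p + 1, x) | x. n \<le> x \<and> x < p \<and> \<not> c x} \<union> {(p, p + 1)}"
  define g' where "g' = (p + 2, snd g \<union> S \<union> S\<inverse>)"
  have g: "snd g \<subseteq> {..<p} \<times> {..<p}" "sym (snd g)"
    using assms(1) by (auto simp: is_fgraph_def p_def)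
  have "sym (snd g')"
    using g(2) by (auto simp: g'_def sym_def)
  moreover have "snd g' \<subseteq> {..<fst g'} \<times> {..<fst g'}"
    using g(1) by (auto simp: g'_def S_def)
  moreover have "proper (snd g') (c(p := False, p + 1 := True))"
    using assms(2) g(1) by (auto simp: g'_def S_def proper_def)
  ultimately have "is_fgraph g'"
    unfolding is_fgraph_def by blast
  then have "gext n g g'"
    using g(1) assms(3) by (auto simp: gext_def g'_def S_def p_def)
  moreover have "c' u \<noteq> c' v"
    if "n \<le> u" "u < fst g" "n \<le> v" "v < fst g" "c u \<noteq> c v" "proper (snd g') c'" for u v c'
  proof -
    have col: "c' p \<noteq> c' (p + 1)" "\<And>x. n \<le> x \<Longrightarrow> x < p \<Longrightarrow> c x \<Longrightarrow> c' x \<noteq> c' p"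
      "\<And>x. n \<le> x \<Longrightarrow> x < p \<Longrightarrow> \<not> c x \<Longrightarrow> c' x \<noteq> c' (p + 1)"
      using that(6) by (auto simp: proper_def g'_def S_def)
    then show ?thesis
      using that(1-5) unfolding p_def by metis
  qed
  ultimately show thesis
    using that by blast
qed

section \<open>Strong forcing by finite initial segments\<close>

definition extends ::
    "nat \<Rightarrow> fgraph \<Rightarrow> (nat \<Rightarrow> nat list) \<Rightarrow> (nat \<times> nat) set \<Rightarrow> (nat \<Rightarrow> nat \<Rightarrow> nat) \<Rightarrow> bool" where
  "extends N g q E f \<longleftrightarrow> E \<inter> ({..<fst g} \<times> {..<fst g}) = snd g \<and>
     (\<forall>i<N. \<forall>d<length (q i). f i d = q i ! d)"

text \<open>All pairs extending the finite data count, generic or not; the bad set is not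
  consulted.\<close>

definition forced ::
    "nat \<Rightarrow> ((nat \<times> nat) set \<Rightarrow> (nat \<Rightarrow> nat \<Rightarrow> nat) \<Rightarrow> bool) \<Rightarrow> fgraph \<Rightarrow> (nat \<Rightarrow> nat list) \<Rightarrow> bool" where
  "forced N \<phi> g q \<longleftrightarrow> (\<forall>E f. extends N g q E f \<longrightarrow> \<phi> E f)"

lemma forced_upd [simp]: "N \<le> i \<Longrightarrow> forced N \<phi> g (q(i := \<tau>)) \<longleftrightarrow> forced N \<phi> g q"
  by (simp add: forced_def extends_def)

text \<open>Forcing is never vacuous: no further edges are added and the strings are continued
  arbitrarily. Hence two different values cannot be forced for one computation.\<close>

lemma forced_realised:
  assumes "is_fgraph g" "forced N \<phi> g q"
  shows "\<exists>E f. extends N g q E f \<and> \<phi> E f"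
proof -
  have "extends N g q (snd g) (\<lambda>i d. q i ! d)"
    using assms(1) by (auto simp: extends_def is_fgraph_def)
  then show ?thesis
    using assms(2) by (auto simp: forced_def)
qed

context order_bound
begin

lemma sext_nth: "sext \<sigma> \<tau> \<Longrightarrow> d < length \<sigma> \<Longrightarrow> d < length \<tau> \<and> \<tau> ! d = \<sigma> ! d"
  by (auto simp: sext_def nth_append)

lemma sext_length: "sext \<sigma> \<tau> \<Longrightarrow> length \<sigma> \<le> length \<tau>"
  by (auto simp: sext_def)

lemma sext_Nil: "sext [] \<tau> \<longleftrightarrow> (\<forall>d<length \<tau>. \<tau> ! d \<le> h d)"
  by (auto simp: sext_def)

lemma extends_antimono:
  assumes "extends N g' r E f" "gext 0 g g'" "\<forall>i. sext (q i) (r i)"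
  shows "extends N g q E f"
proof -
  have "E \<inter> ({..<fst g} \<times> {..<fst g}) =
      (E \<inter> ({..<fst g'} \<times> {..<fst g'})) \<inter> ({..<fst g} \<times> {..<fst g})"
    using gext_le[OF assms(2)] by auto
  also have "\<dots> = snd g"
    using assms(1,2) by (auto simp: extends_def gext_def)
  finally show ?thesis
    using assms sext_nth unfolding extends_def by metis
qed

lemma forced_mono:
  "forced N \<phi> g q \<Longrightarrow> gext 0 g g' \<Longrightarrow> \<forall>i. sext (q i) (r i) \<Longrightarrow> forced N \<phi> g' r"
  unfolding forced_def using extends_antimono by blast

lemma upcI:
  "(\<And>g q g' r. A g q \<Longrightarrow> gext 0 g g' \<Longrightarrow> fst g \<le> fst g' \<Longrightarrow> \<forall>i. sext (q i) (r i) \<Longrightarrow> A g' r) \<Longrightarrow> upc A"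
  unfolding upc_def using gext_le by blast

lemma upc_disj: "upc A \<Longrightarrow> upc B \<Longrightarrow> upc (\<lambda>g r. A g r \<or> B g r)"
  unfolding upc_def by blast

lemma upc_conj: "upc A \<Longrightarrow> upc B \<Longrightarrow> upc (\<lambda>g r. A g r \<and> B g r)"
  unfolding upc_def by blast

section \<open>Conditions and their extensions\<close>

definition indep :: "nat \<Rightarrow> (fgraph \<Rightarrow> (nat \<Rightarrow> nat list) \<Rightarrow> bool) \<Rightarrow> bool" where
  "indep N B \<longleftrightarrow> (\<forall>i\<ge>N. \<forall>g q \<tau>. B g (q(i := \<tau>)) \<longleftrightarrow> B g q)"

text \<open>\<open>B\<close> is the bad set. Its smallness is tested with all present vertices
  frozen, which stays true when more vertices are frozen. The upper bound on \<open>k i\<close> is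
  the one under which \<open>big_length\<close> applies.\<close>

definition cond ::
    "nat \<Rightarrow> fgraph \<Rightarrow> (nat \<Rightarrow> nat list) \<Rightarrow> (nat \<Rightarrow> nat) \<Rightarrow> (fgraph \<Rightarrow> (nat \<Rightarrow> nat list) \<Rightarrow> bool) \<Rightarrow> bool"
  where "cond N g q k B \<longleftrightarrow> is_fgraph g \<and> upc B \<and> indep N B \<and>
    (\<forall>i. sext [] (q i)) \<and> (\<forall>i\<ge>N. q i = []) \<and> (\<forall>i. 0 < k i) \<and>
    (\<forall>i<N. k i \<le> h (length (q i)) + 1) \<and> \<not> nbig (fst g) k N B g q"

lemma nbig_cong: "(\<And>i. i < N \<Longrightarrow> k i = k' i) \<Longrightarrow> nbig l k N A g q \<longleftrightarrow> nbig l k' N A g q"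
  by (induction N arbitrary: A) simp_all

text \<open>The graph is chosen before the trees, so one \<open>g'\<close> serves all leaves. Once
  it is fixed, bigness concerns strings only and no longer depends on the current graph or on what
  is frozen.\<close>

lemma nbig_graph:
  assumes "nbig l k N A g q"
  shows "\<exists>g'. gext l g g' \<and> (\<forall>l' g''. is_fgraph g'' \<longrightarrow> nbig l' k N (\<lambda>_ r. A g' r) g'' q)"
  using assms
proof (induction N arbitrary: A)
  case 0
  then show ?case unfolding nbig.simps using gext_refl by blast
next
  case (Suc i)
  show ?case
    unfolding nbig.simps by (rule Suc.IH[OF Suc.prems[unfolded nbig.simps]])
qed

lemma cond_extend:
  assumes "cond N g q k B" "gext (fst g) g g'" "qext N q r" "upc B'" "indep N B'"
    "\<not> nbig (fst g') k' N B' g' r" "\<And>i. 0 < k' i" "\<And>i. i < N \<Longrightarrow> k' i \<le> h (length (q i)) + 1"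
  shows "cond N g' r k' B'"
  unfolding cond_def
proof (intro conjI allI impI)
  show "is_fgraph g'"
    using assms(2) gext_fgraph by blast
  show "sext [] (r i)" for i
    using assms(1,3) sext_trans unfolding cond_def qext_def by blast
  show "r i = []" if "N \<le> i" for i
    using assms(1,3) that unfolding cond_def qext_def by simp
  show "k' i \<le> h (length (r i)) + 1" if "i < N" for i
  proof -
    have "sext (q i) (r i)"
      using assms(3) by (simp add: qext_def)
    then show ?thesis
      using assms(8)[OF that] h_mono[OF sext_length] by (meson add_le_mono1 le_trans)
  qed
qed (use assms in auto)

text \<open>The new tree starts at the empty string with bushiness 2, admissible because
  \<open>h 0\<close> is at least 1. Values of \<open>\<Psi>\<close> are forced by the coordinates
  below \<open>N\<close> alone, so each argument forbids at most one value and
  \<open>diagonal_not_big\<close> applies.\<close>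

lemma cond_add_coordinate:
  fixes \<Psi> :: "(nat \<times> nat) set \<Rightarrow> (nat \<Rightarrow> nat \<Rightarrow> nat) \<Rightarrow> nat \<Rightarrow> nat option"
  assumes "cond N g q k B"
  defines "D \<equiv> \<lambda>g r. \<exists>d<length (r N). forced N (\<lambda>E f. \<Psi> E f d = Some (r N ! d)) g r"
  shows "cond (Suc N) g q (k(N := 2)) (\<lambda>g r. B g r \<or> D g r)"
  unfolding cond_def
proof (intro conjI allI impI)
  have D: "upc D"
  proof (rule upcI)
    fix g q g' r assume D: "D g q" and g': "gext 0 g g'" and s: "\<forall>i. sext (q i) (r i)"
    obtain d where d: "d < length (q N)" "forced N (\<lambda>E f. \<Psi> E f d = Some (q N ! d)) g q"
      using D unfolding D_def by blast
    have "d < length (r N)" "r N ! d = q N ! d"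
      using sext_nth[OF s[rule_format] d(1)] by auto
    then show "D g' r"
      unfolding D_def using forced_mono[OF d(2) g' s] by auto
  qed
  show "upc (\<lambda>g r. B g r \<or> D g r)"
    using D assms(1) upc_disj unfolding cond_def by blast
  show "indep (Suc N) (\<lambda>g r. B g r \<or> D g r)"
    using assms(1) unfolding cond_def indep_def D_def by simp
  show "(k(N := 2)) i \<le> h (length (q i)) + 1" if "i < Suc N" for i
    using assms(1) that pos unfolding cond_def by (cases "i = N") auto
  show "\<not> nbig (fst g) (k(N := 2)) (Suc N) (\<lambda>g r. B g r \<or> D g r) g q"
  proof
    assume "nbig (fst g) (k(N := 2)) (Suc N) (\<lambda>g r. B g r \<or> D g r) g q"
    then have "nbig (fst g) (k(N := 2)) N
        (\<lambda>g' r. big 2 (\<lambda>\<tau>. B g' (r(N := \<tau>)) \<or> D g' (r(N := \<tau>))) (r N)) g q"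
      by simp
    then have "nbig (fst g) (k(N := 2)) N B g q"
    proof (rule nbig_mono)
      fix g' r
      assume g': "gext (fst g) g g'" and r: "qext N q r"
        and b: "big 2 (\<lambda>\<tau>. B g' (r(N := \<tau>)) \<or> D g' (r(N := \<tau>))) (r N)"
      show "B g' r"
      proof (rule ccontr)
        assume "\<not> B g' r"
        \<comment> \<open>\<open>B\<close> does not see coordinate \<open>N\<close>, so every leaf
          of the 2-bushy tree would have to lie in \<open>D\<close>.\<close>
        then have "\<not> B g' (r(N := \<tau>))" for \<tau>
          using assms(1) unfolding cond_def indep_def by blast
        moreover have "r N = []"
          using r assms(1) by (simp add: qext_def cond_def)
        ultimately have "big 2 (\<lambda>\<tau>. \<exists>d<length \<tau>. forced N (\<lambda>E f. \<Psi> E f d = Some (\<tau> ! d)) g' r) []"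
          using b unfolding D_def by simp
        moreover have "a = b" if "forced N (\<lambda>E f. \<Psi> E f d = Some a) g' r"
            "forced N (\<lambda>E f. \<Psi> E f d = Some b) g' r" for d a b
          using forced_realised[OF gext_fgraph[OF g'] that(1)] that(2) unfolding forced_def by fastforce
        ultimately show False
          using diagonal_not_big[of "\<lambda>d a. forced N (\<lambda>E f. \<Psi> E f d = Some a) g' r" "[]"] by auto
      qed
    qed
    then show False
      using assms(1) nbig_cong[of N k "k(N := 2)"] unfolding cond_def by simp
  qed
qed (use assms(1) in \<open>auto simp: cond_def\<close>)

text \<open>Long strings form a big set, so they can be reached while the bad set stays small. As
  \<open>h\<close> is unbounded, this makes room for greater bushiness.\<close>

lemma cond_lengthen:
  assumes "cond N g q k B"
  obtains g' r where "cond N g' r k B" "gext (fst g) g g'" "qext N q r" "L \<le> fst g'"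
    "\<And>i. i < N \<Longrightarrow> L \<le> length (r i)"
proof -
  let ?A = "\<lambda>g' r. L \<le> fst (g' :: fgraph) \<and> (\<forall>i<N. L \<le> length (r i :: nat list))"
  have "nbig (fst g) k N ?A g q"
    using assms by (intro nbig_length) (auto simp: cond_def)
  moreover have "upc ?A"
    by (rule upcI) (meson le_trans sext_length)
  ultimately obtain g' r where *: "gext (fst g) g g'" "qext N q r" "?A g' r"
      "\<not> nbig (fst g) k N B g' r"
    using nbig_pick assms unfolding cond_def by blast
  have "cond N g' r k B"
  proof (rule cond_extend[OF assms *(1,2)])
    show "\<not> nbig (fst g') k N B g' r"
      using *(4) nbig_lock gext_le[OF *(1)] by blast
  qed (use assms in \<open>auto simp: cond_def\<close>)
  then show thesis
    using * that by blast
qed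

text \<open>Either all large elements of \<open>H\<close> become bad, which makes \<open>H\<close>
  finite along the generic sequence, or two forced elements are separated by every proper colouring,
  so that no homogeneous set contains both.\<close>

lemma cond_requirement:
  fixes N and H :: "(nat \<times> nat) set \<Rightarrow> (nat \<Rightarrow> nat \<Rightarrow> nat) \<Rightarrow> nat set"
  defines "F \<equiv> \<lambda>u. forced N (\<lambda>E f. u \<in> H E f)"
  assumes cond: "cond N g q k B" and room: "\<And>i. i < N \<Longrightarrow> 4 * k i \<le> h (length (q i)) + 1"
  obtains g' r k' B' where "cond N g' r k' B'" "gext (fst g) g g'" "qext N q r"
    "\<forall>g r. B g r \<longrightarrow> B' g r"
    "(\<exists>m. \<forall>g r u. m \<le> u \<and> u < fst g \<and> F u g r \<longrightarrow> B' g r) \<or>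
     (\<exists>u v. F u g' r \<and> F v g' r \<and> u < fst g' \<and> v < fst g' \<and>
        (\<forall>c. proper (snd g') c \<longrightarrow> c u \<noteq> c v))"
proof -
  \<comment> \<open>\<open>m\<close> pays for halving the leaves by colour, \<open>l\<close> for removing the bad ones beforehand, and
    \<open>k + l - 1 = 4 k - 3\<close> is the bigness needed when the first search fails.\<close>
  define n where "n = fst g"
  define m where "m = (\<lambda>i. k i + k i - 1)"
  define l where "l = (\<lambda>i. k i + m i - 1)"
  have B: "upc B" "indep N B" "\<not> nbig n k N B g q" and g: "is_fgraph g" and k: "0 < k i" for i
    using cond by (auto simp: cond_def n_def)
  have m: "0 < m i" and l: "0 < l i" for i
    using k[of i] by (auto simp: m_def l_def)
  have F_upc: "F u g' r" if "F u g q" "gext 0 g g'" "\<forall>i. sext (q i) (r i)" for u g q g' r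
    using that forced_mono unfolding F_def by blast
  have F_upd: "F u g (q(i := \<tau>)) \<longleftrightarrow> F u g q" if "N \<le> i" for u g q i \<tau>
    using that by (simp add: F_def)
  define above where "above a g' r \<longleftrightarrow> (\<exists>u. a \<le> u \<and> u < fst g' \<and> F u g' r)" for a g' r
  have upc_above: "upc (above a)" for a
    unfolding above_def by (rule upcI) (meson F_upc less_le_trans)
  have indep_above: "indep N (above a)" for a
    unfolding above_def indep_def by (simp add: F_upd)
  show thesis
  proof (cases "nbig n l N (above n) g q")
    case False
    \<comment> \<open>Neither set is big for its own bushiness, so their union is not big for the
      combined one and can serve as the new bad set.\<close>
    have nb: "\<not> nbig (fst g) (\<lambda>i. k i + l i - 1) N (\<lambda>g r. B g r \<or> above n g r) g q"
      using nbig_split[of n k l N B "above n" g q] k l False B unfolding n_def by blast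
    have "cond N g q (\<lambda>i. k i + l i - 1) (\<lambda>g r. B g r \<or> above n g r)"
    proof (rule cond_extend[OF cond])
      show "indep N (\<lambda>g r. B g r \<or> above n g r)"
        using B(2) indep_above[of n] unfolding indep_def by simp
      show "k i + l i - 1 \<le> h (length (q i)) + 1" if "i < N" for i
        using room[OF that] k[of i] by (simp add: l_def m_def)
      show "0 < k i + l i - 1" for i
        using k[of i] l[of i] by simp
    qed (use nb g B gext_refl upc_above upc_disj in auto)
    then show thesis
      by (rule that) (use g gext_refl in \<open>auto simp: above_def\<close>)
  next
    case True
    \<comment> \<open>The graph found by the first search is fixed here; its size \<open>n'\<close>
      separates the old targets (\<open>low\<close>) from those of the second search.\<close>
    obtain g' where g': "gext n g g'" "\<And>l'. nbig l' l N (\<lambda>_ r. above n g' r) g' q"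
      using nbig_graph[OF True] gext_fgraph by blast
    define n' where "n' = fst g'"
    have nn': "n \<le> n'"
      using g' gext_le unfolding n_def n'_def by blast
    define low where "low g1 r \<longleftrightarrow> (\<exists>u. n \<le> u \<and> u < n' \<and> F u g1 r)" for g1 r
    have upc_low: "upc low"
      unfolding low_def by (rule upcI) (meson F_upc)
    have low: "nbig n' l N low g' q"
      using g'(2)
    proof (rule nbig_mono)
      fix g1 r assume "gext n' g' g1" "above n g' r"
      then show "low g1 r"
        unfolding low_def above_def n'_def
        using F_upc gext_mono le0 sext_refl by meson
    qed
    let ?C = "\<lambda>g r. B g r \<or> above n' g r"
    have upc_C: "upc ?C"
      using B upc_above upc_disj by blast
    show thesis
    \<comment> \<open>One extension above which \<open>?C\<close> is small counts as failure of the
      second search. Otherwise \<open>?C\<close> is big above every extension, as the use of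
      \<open>nbig_trans\<close> requires.\<close>
    proof (cases "\<exists>g1 r. gext n' g' g1 \<and> qext N q r \<and> \<not> nbig n' l N ?C g1 r")
      case True
      then obtain g1 r where g1: "gext n' g' g1" "qext N q r" "\<not> nbig n' l N ?C g1 r"
        by blast
      have gg1: "gext (fst g) g g1"
        using g'(1) g1(1) gext_mono[OF _ nn'] gext_trans unfolding n_def by blast
      have "cond N g1 r l ?C"
      proof (rule cond_extend[OF cond gg1 g1(2) upc_C])
        show "indep N ?C"
          using B(2) indep_above[of n'] unfolding indep_def by simp
        show "\<not> nbig (fst g1) l N ?C g1 r"
          using g1(3) nbig_lock gext_le[OF g1(1)] unfolding n'_def by blast
        show "l i \<le> h (length (q i)) + 1" if "i < N" for i
          using room[OF that] k[of i] by (simp add: l_def m_def)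
      qed (rule l)
      then show thesis
        by (rule that) (use gg1 g1 in \<open>auto simp: above_def\<close>)
    next
      case False
      have "nbig n' l N (\<lambda>g r. ?C g r \<and> low g r) g' q"
      proof (rule nbig_trans[OF upc_low upc_conj[OF upc_C upc_low] low])
        fix g1 r assume 1: "gext n' g' g1" "qext N q r" "low g1 r"
        then have "nbig n' l N ?C g1 r"
          using False by blast
        then show "nbig n' l N (\<lambda>g r. ?C g r \<and> low g r) g1 r"
          by (rule nbig_mono) (use 1 upc_low upcD in blast)
      qed
      \<comment> \<open>Leaves in \<open>B\<close> are set apart; as \<open>B\<close> is not
        \<open>k\<close>-big, \<open>nbig_split\<close> leaves an \<open>m\<close>-big set of the
        others.\<close>
      then have "nbig n' (\<lambda>i. k i + m i - 1) N (\<lambda>g r. B g r \<or> low g r \<and> above n' g r) g' q"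
        unfolding l_def by (rule nbig_mono) blast
      moreover have "\<not> nbig n' k N B g' q"
        using B(3) nbig_lock[OF _ nn'] nbig_gext[OF _ g'(1)] by blast
      ultimately have split_big: "nbig n' m N (\<lambda>g r. low g r \<and> above n' g r) g' q"
        using nbig_split[where A = B and B = "\<lambda>g r. low g r \<and> above n' g r" and k = k and m = m] k m
        by blast
      obtain g2 where g2: "gext n' g' g2"
          "nbig n m N (\<lambda>_ r. low g2 r \<and> above n' g2 r) g2 q"
        using nbig_graph[OF split_big] gext_fgraph by blast
      obtain c0 where c0: "proper (snd g2) c0"
        using gext_fgraph[OF g2(1)] by (auto simp: is_fgraph_def)
      \<comment> \<open>The flip of \<open>c0\<close> on the vertices from \<open>n'\<close> on. The
        second search kept the vertices below \<open>n'\<close> frozen, so no edge crosses and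
        \<open>c1\<close> is proper too.\<close>
      define c1 where "c1 x = (c0 x \<noteq> (n' \<le> x))" for x
      have same_side: "a < n' \<longleftrightarrow> b < n'" if "(a, b) \<in> snd g2" for a b
      proof -
        have "(b, a) \<in> snd g2"
          using that gext_fgraph[OF g2(1)] by (auto simp: is_fgraph_def dest: symD)
        moreover have "snd g' \<subseteq> {..<n'} \<times> {..<n'}"
          using gext_fgraph[OF g'(1)] by (simp add: is_fgraph_def n'_def)
        moreover have "(x, y) \<in> snd g'" if "(x, y) \<in> snd g2" "x < n'" for x y
          using that g2(1) unfolding gext_def by blast
        ultimately show ?thesis
          using that by blast
      qed
      have "c1 a \<noteq> c1 b" if "(a, b) \<in> snd g2" for a b
      proof -
        have "c0 a \<noteq> c0 b"
          using c0 that unfolding proper_def by blast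
        then show ?thesis
          using same_side[OF that] unfolding c1_def by auto
      qed
      then have c1: "proper (snd g2) c1"
        unfolding proper_def by blast
      define split where "split c g1 r \<longleftrightarrow> (\<exists>u v. n \<le> u \<and> u < n' \<and> n' \<le> v \<and> v < fst g2 \<and>
        F u g1 r \<and> F v g1 r \<and> c u \<noteq> c v)" for c :: "nat \<Rightarrow> bool" and g1 r
      have upc_split: "upc (split c)" for c
        unfolding split_def by (rule upcI) (meson F_upc)
      \<comment> \<open>At every leaf \<open>u\<close> is old and \<open>v\<close> is new, so the
        flip changes whether they differ in colour and one of the two colourings separates
        them.\<close>
      have "nbig n (\<lambda>i. k i + k i - 1) N (\<lambda>_ r. split c0 g2 r \<or> split c1 g2 r) g2 q"
        using g2(2) unfolding m_def
      proof (rule nbig_mono)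
        fix r assume "low g2 r \<and> above n' g2 r"
        then obtain u v where uv: "n \<le> u" "u < n'" "F u g2 r" "n' \<le> v" "v < fst g2" "F v g2 r"
          unfolding low_def above_def by blast
        then have "c0 u \<noteq> c0 v \<or> c1 u \<noteq> c1 v"
          unfolding c1_def by auto
        then show "split c0 g2 r \<or> split c1 g2 r"
          unfolding split_def using uv by blast
      qed
      then have "nbig n k N (\<lambda>_ r. split c0 g2 r) g2 q \<or> nbig n k N (\<lambda>_ r. split c1 g2 r) g2 q"
        using nbig_split[where A = "\<lambda>_ r. split c0 g2 r" and B = "\<lambda>_ r. split c1 g2 r" and k = k and m = k] k
        by blast
      then obtain c where c: "proper (snd g2) c" "nbig n k N (\<lambda>_ r. split c g2 r) g2 q"
        using c0 c1 by blast
      have gg2: "gext n g g2"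
        using g'(1) g2(1) gext_mono[OF _ nn'] gext_trans by blast
      have n'2: "n' \<le> fst g2"
        using gext_le[OF g2(1)] by (simp add: n'_def)
      \<comment> \<open>The freezing level drops back to \<open>n\<close>, since vertices between
        \<open>n\<close> and \<open>n'\<close> also receive edges to the linking vertices.\<close>
      obtain g3 where g3: "gext n g2 g3"
          "\<forall>u v c'. n \<le> u \<and> u < fst g2 \<and> n \<le> v \<and> v < fst g2 \<and> c u \<noteq> c v \<and> proper (snd g3) c'
            \<longrightarrow> c' u \<noteq> c' v"
        by (rule link_colour_classes[OF gext_fgraph[OF g2(1)] c(1) le_trans[OF nn' n'2]])
      have "nbig n k N (\<lambda>_ r. split c g2 r) g3 q"
        using nbig_graph[OF c(2)] gext_fgraph[OF g3(1)] by blast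
      then have "nbig n k N (split c) g3 q"
      proof (rule nbig_mono)
        fix g4 r assume "gext n g3 g4" "split c g2 r"
        then show "split c g4 r"
          using upcD[OF upc_split] g3(1) gext_trans qext_refl by blast
      qed
      moreover have "\<not> nbig n k N B g3 q"
        using B(3) nbig_gext gg2 g3(1) by blast
      ultimately obtain g4 r where 4: "gext n g3 g4" "qext N q r" "split c g4 r" "\<not> nbig n k N B g4 r"
        using nbig_pick[OF upc_split B(1)] by blast
      have gg4: "gext (fst g) g g4"
        using gg2 g3(1) 4(1) gext_trans unfolding n_def by blast
      have "cond N g4 r k B"
      proof (rule cond_extend[OF cond gg4 4(2) B(1,2) _ k])
        show "\<not> nbig (fst g4) k N B g4 r"
          using 4(4) nbig_lock gext_le[OF gg4] unfolding n_def by blast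
        show "k i \<le> h (length (q i)) + 1" if "i < N" for i
          using room[OF that] by simp
      qed
      then show thesis
      proof (rule that)
        obtain u v where uv: "n \<le> u" "u < n'" "n' \<le> v" "v < fst g2" "F u g4 r" "F v g4 r" "c u \<noteq> c v"
          using 4(3) unfolding split_def by blast
        have "c' u \<noteq> c' v" if "proper (snd g4) c'" for c'
        proof -
          have "proper (snd g3) c'"
            using that gext_sub[OF 4(1)] unfolding proper_def by blast
          moreover have "u < fst g2" "n \<le> v"
            using uv nn' n'2 by auto
          ultimately show ?thesis
            using g3(2) uv by blast
        qed
        moreover have "fst g2 \<le> fst g4"
          using gext_le[OF g3(1)] gext_le[OF 4(1)] by simp
        then have "u < fst g4" "v < fst g4"
          using uv n'2 by linarith+
        ultimately show "(\<exists>m. \<forall>g r u. m \<le> u \<and> u < fst g \<and> F u g r \<longrightarrow> B g r) \<or>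
            (\<exists>u v. F u g4 r \<and> F v g4 r \<and> u < fst g4 \<and> v < fst g4 \<and>
              (\<forall>c. proper (snd g4) c \<longrightarrow> c u \<noteq> c v))"
          using uv(5,6) by blast
      qed (use 4 gg4 in auto)
    qed
  qed
qed

end

section \<open>The generic sequence\<close>

definition agree ::
    "nat \<Rightarrow> nat \<Rightarrow> (nat \<times> nat) set \<Rightarrow> (nat \<Rightarrow> nat \<Rightarrow> nat) \<Rightarrow> (nat \<times> nat) set \<Rightarrow> (nat \<Rightarrow> nat \<Rightarrow> nat) \<Rightarrow> bool"
  where "agree N n E f E' f' \<longleftrightarrow>
    (\<forall>a<n. \<forall>b<n. (a, b) \<in> E \<longleftrightarrow> (a, b) \<in> E') \<and> (\<forall>i<N. \<forall>d<n. f i d = f' i d)"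

text \<open>Openness in the product topology, with dependence on the first \<open>N\<close>
  functions only.\<close>

definition finitary :: "nat \<Rightarrow> ((nat \<times> nat) set \<Rightarrow> (nat \<Rightarrow> nat \<Rightarrow> nat) \<Rightarrow> bool) \<Rightarrow> bool" where
  "finitary N \<phi> \<longleftrightarrow> (\<forall>E f. \<phi> E f \<longrightarrow> (\<exists>n. \<forall>E' f'. agree N n E f E' f' \<longrightarrow> \<phi> E' f'))"

context order_bound
begin

lemma h_eventually_ge:
  assumes "finite I"
  shows "\<exists>L. \<forall>i\<in>I. k i \<le> h L"
proof -
  obtain L where "sum k I < h L"
    using is_order by (auto simp: is_order_def)
  then show ?thesis
    using member_le_sum[of _ I k] assms by (metis less_imp_le_nat order_trans zero_le)
qed

text \<open>One stage: add coordinate \<open>N\<close>, lengthen until \<open>h\<close> is at least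
  four times the bushiness, then treat \<open>H\<close>. The lower bounds by \<open>N\<close> make
  the limit functions total and the limit graph infinite.\<close>

lemma cond_step:
  fixes N and H :: "(nat \<times> nat) set \<Rightarrow> (nat \<Rightarrow> nat \<Rightarrow> nat) \<Rightarrow> nat set"
    and \<Psi> :: "(nat \<times> nat) set \<Rightarrow> (nat \<Rightarrow> nat \<Rightarrow> nat) \<Rightarrow> nat \<Rightarrow> nat option"
  defines "F \<equiv> \<lambda>u. forced (Suc N) (\<lambda>E f. u \<in> H E f)"
  defines "D \<equiv> \<lambda>g r. \<exists>d<length (r N). forced N (\<lambda>E f. \<Psi> E f d = Some (r N ! d)) g r"
  assumes "cond N g q k B"
  obtains g' r k' B' where "cond (Suc N) g' r k' B'" "gext (fst g) g g'" "qext (Suc N) q r"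
    "\<forall>g r. B g r \<or> D g r \<longrightarrow> B' g r" "N \<le> fst g'" "\<forall>i\<le>N. N \<le> length (r i)"
    "(\<exists>m. \<forall>g r u. m \<le> u \<and> u < fst g \<and> F u g r \<longrightarrow> B' g r) \<or>
     (\<exists>u v. F u g' r \<and> F v g' r \<and> u < fst g' \<and> v < fst g' \<and>
        (\<forall>c. proper (snd g') c \<longrightarrow> c u \<noteq> c v))"
proof -
  let ?k = "k(N := 2)" and ?B = "\<lambda>g r. B g r \<or> D g r"
  have 1: "cond (Suc N) g q ?k ?B"
    unfolding D_def by (rule cond_add_coordinate[OF assms(3)])
  obtain L where L: "\<forall>i\<in>{..N}. 4 * ?k i \<le> h L"
    using h_eventually_ge[of "{..N}" "\<lambda>i. 4 * ?k i"] by auto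
  obtain g1 q1 where 2: "cond (Suc N) g1 q1 ?k ?B" "gext (fst g) g g1" "qext (Suc N) q q1"
      "max L N \<le> fst g1" "\<And>i. i < Suc N \<Longrightarrow> max L N \<le> length (q1 i)"
    using cond_lengthen[OF 1, of "max L N"] by blast
  have room: "4 * ?k i \<le> h (length (q1 i)) + 1" if "i < Suc N" for i
  proof -
    have "4 * ?k i \<le> h L" "L \<le> length (q1 i)"
      using L 2(5)[OF that] that by (auto simp: less_Suc_eq_le)
    then show ?thesis
      using h_mono le_trans trans_le_add1 by meson
  qed
  have F: "forced (Suc N) (\<lambda>E f. u \<in> H E f) = F u" for u
    by (simp add: F_def)
  obtain g2 q2 k2 B2 where 3: "cond (Suc N) g2 q2 k2 B2" "gext (fst g1) g1 g2" "qext (Suc N) q1 q2"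
      "\<forall>g r. ?B g r \<longrightarrow> B2 g r"
    and met: "(\<exists>m. \<forall>g r u. m \<le> u \<and> u < fst g \<and> F u g r \<longrightarrow> B2 g r) \<or>
     (\<exists>u v. F u g2 q2 \<and> F v g2 q2 \<and> u < fst g2 \<and> v < fst g2 \<and>
        (\<forall>c. proper (snd g2) c \<longrightarrow> c u \<noteq> c v))"
    by (rule cond_requirement[where H = H, OF 2(1) room, unfolded F]) (assumption, rule that)
  have "gext (fst g) g g2"
    using 2(2) 3(2) gext_mono gext_le gext_trans by blast
  moreover have "qext (Suc N) q q2"
    using 2(3) 3(3) qext_trans by blast
  moreover have "N \<le> fst g2"
    using 2(4) gext_le[OF 3(2)] by simp
  moreover have "N \<le> length (q2 i)" if "i \<le> N" for i
  proof -
    have "sext (q1 i) (q2 i)"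
      using 3(3) by (simp add: qext_def)
    then show ?thesis
      using 2(5)[of i] that sext_length by fastforce
  qed
  ultimately show thesis
    using that[OF 3(1) _ _ 3(4)] met by blast
qed

text \<open>Stage \<open>i\<close> adds \<open>f i\<close> and treats both \<open>\<Psi> i\<close>
  and \<open>H i\<close>. The diagonalised \<open>\<Psi> i\<close> may consult only functions before
  \<open>f i\<close>, whereas \<open>H i\<close> may consult \<open>f i\<close> itself.\<close>

lemma generic_graph:
  fixes \<Psi> :: "nat \<Rightarrow> (nat \<times> nat) set \<Rightarrow> (nat \<Rightarrow> nat \<Rightarrow> nat) \<Rightarrow> nat \<Rightarrow> nat option"
    and H :: "nat \<Rightarrow> (nat \<times> nat) set \<Rightarrow> (nat \<Rightarrow> nat \<Rightarrow> nat) \<Rightarrow> nat set"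
  assumes \<Psi>: "\<And>i d y. finitary i (\<lambda>E f. \<Psi> i E f d = Some y)"
    and H: "\<And>s u. finitary (Suc s) (\<lambda>E f. u \<in> H s E f)"
  obtains E f where "sym E" "\<forall>n. \<exists>c. proper (E \<inter> ({..<n} \<times> {..<n})) c"
    "\<forall>i. h_bounded h (f i)" "\<forall>i d. \<Psi> i E f d \<noteq> Some (f i d)"
    "\<forall>s. finite (H s E f) \<or> (\<exists>u\<in>H s E f. \<exists>v\<in>H s E f. \<exists>n. u < n \<and> v < n \<and>
       (\<forall>c. proper (E \<inter> ({..<n} \<times> {..<n})) c \<longrightarrow> c u \<noteq> c v))"
proof -
  define P where "P s = (\<lambda>(g, q, k, B). cond s g q k B)" for s
  define F where "F s u = forced (Suc s) (\<lambda>E f. u \<in> H s E f)" for s u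
  define D where "D s g r \<longleftrightarrow> (\<exists>d<length (r s). forced s (\<lambda>E f. \<Psi> s E f d = Some (r s ! d)) g r)" for s g r
  define met where "met s g' r B' \<longleftrightarrow> (\<exists>m. \<forall>g r u. m \<le> u \<and> u < fst g \<and> F s u g r \<longrightarrow> B' g r) \<or>
     (\<exists>u v. F s u g' r \<and> F s v g' r \<and> u < fst g' \<and> v < fst g' \<and>
        (\<forall>c. proper (snd g') c \<longrightarrow> c u \<noteq> c v))" for s g' r B'
  define Q where "Q s = (\<lambda>(g, q, k :: nat \<Rightarrow> nat, B) (g', r, k' :: nat \<Rightarrow> nat, B').
    gext (fst g) g g' \<and> qext (Suc s) q r \<and> (\<forall>g r. B g r \<or> D s g r \<longrightarrow> B' g r) \<and>
    s \<le> fst g' \<and> (\<forall>i\<le>s. s \<le> length (r i)) \<and> met s g' r B')" for s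
  have start: "P 0 ((0, {}), \<lambda>_. [], \<lambda>_. 1, \<lambda>_ _. False)"
    by (auto simp: P_def cond_def is_fgraph_def proper_def sym_def upc_def indep_def)
  have step: "\<exists>y. P (Suc s) y \<and> Q s x y" if "P s x" for x s
  proof -
    obtain g q k B where x: "x = (g, q, k, B)"
      by (cases x) auto
    have c: "cond s g q k B"
      using that by (simp add: P_def x)
    obtain g' r k' B' where "cond (Suc s) g' r k' B'" "gext (fst g) g g'" "qext (Suc s) q r"
      "\<forall>g r. B g r \<or> D s g r \<longrightarrow> B' g r" "s \<le> fst g'" "\<forall>i\<le>s. s \<le> length (r i)" "met s g' r B'"
      by (rule cond_step[where \<Psi> = "\<Psi> s" and H = "H s", OF c,
            folded F_def, folded D_def, folded met_def]) (rule that)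
    then have "P (Suc s) (g', r, k', B') \<and> Q s x (g', r, k', B')"
      unfolding P_def Q_def x by simp
    then show ?thesis ..
  qed
  obtain p where p: "\<And>s. P s (p s)" "\<And>s. Q s (p s) (p (Suc s))"
    using dependent_nat_choice[of P Q] start step by metis
  define g q k B where "g s = fst (p s)" and "q s = fst (snd (p s))"
    and "k s = fst (snd (snd (p s)))" and "B s = snd (snd (snd (p s)))" for s
  have p_eq: "p s = (g s, q s, k s, B s)" for s
    by (simp add: g_def q_def k_def B_def)
  have cond: "cond s (g s) (q s) (k s) (B s)" for s
    using p(1)[of s] by (simp add: P_def p_eq)
  have Q_all: "gext (fst (g s)) (g s) (g (Suc s)) \<and> qext (Suc s) (q s) (q (Suc s)) \<and>
      (\<forall>g' r. B s g' r \<or> D s g' r \<longrightarrow> B (Suc s) g' r) \<and> s \<le> fst (g (Suc s)) \<and>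
      (\<forall>i\<le>s. s \<le> length (q (Suc s) i)) \<and> met s (g (Suc s)) (q (Suc s)) (B (Suc s))" for s
    using p(2)[of s] unfolding Q_def p_eq prod.case .
  have Q: "gext (fst (g s)) (g s) (g (Suc s))" "qext (Suc s) (q s) (q (Suc s))"
      "B s g' r \<or> D s g' r \<Longrightarrow> B (Suc s) g' r" "s \<le> fst (g (Suc s))"
      "i \<le> s \<Longrightarrow> s \<le> length (q (Suc s) i)" "met s (g (Suc s)) (q (Suc s)) (B (Suc s))"
    for s g' r i
    using Q_all by blast+
  have fg: "is_fgraph (g s)" for s
    using cond by (simp add: cond_def)
  have g_mono: "gext 0 (g s) (g t)" if "s \<le> t" for s t
    using that
  proof (induction rule: dec_induct)
    case base
    show ?case using fg gext_refl by blast
  next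
    case (step n)
    have "gext 0 (g n) (g (Suc n))"
      using Q(1) gext_mono by blast
    with step.IH show ?case by (rule gext_trans)
  qed
  have q_mono: "sext (q s i) (q t i)" if "s \<le> t" for s t i
    using that
  proof (induction rule: dec_induct)
    case (step n)
    have "sext (q n i) (q (Suc n) i)"
      using Q(2)[of n] by (simp add: qext_def)
    with step.IH show ?case by (rule sext_trans)
  qed simp
  have B_mono: "B t g' r" if "B s g' r" "s \<le> t" for s t g' r
    using that(2,1)
  proof (induction rule: dec_induct)
    case (step n)
    then show ?case using Q(3)[of n] by simp
  qed
  \<comment> \<open>A condition inside its own bad set would make that set big through trivial
    trees.\<close>
  have not_B: "\<not> B s (g s) (q s)" for s
    using cond[of s] nbig_here[where A = "B s", OF _ fg[of s], of "q s" "fst (g s)" "k s" s]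
    unfolding cond_def by argo

  define E where "E = (\<Union>s. snd (g s))"
  \<comment> \<open>At this stage the string for coordinate \<open>i\<close> is already longer than
    \<open>d\<close>, so \<open>!\<close> reads a genuine entry, which later stages keep.\<close>
  define f where "f i d = q (Suc (i + Suc d)) i ! d" for i d
  have E: "E \<inter> ({..<fst (g s)} \<times> {..<fst (g s)}) = snd (g s)" for s
  proof
    show "snd (g s) \<subseteq> E \<inter> ({..<fst (g s)} \<times> {..<fst (g s)})"
      using fg[of s] unfolding E_def is_fgraph_def by blast
    have "snd (g t) \<inter> ({..<fst (g s)} \<times> {..<fst (g s)}) \<subseteq> snd (g s)" for t
    proof (cases "s \<le> t")
      case True
      then show ?thesis using g_mono[OF True] unfolding gext_def by blast
    next
      case False
      then show ?thesis using gext_sub[OF g_mono[of t s]] by auto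
    qed
    then show "E \<inter> ({..<fst (g s)} \<times> {..<fst (g s)}) \<subseteq> snd (g s)"
      unfolding E_def by blast
  qed
  have f: "f i d = q s i ! d" if "d < length (q s i)" for s i d
  proof -
    let ?t = "Suc (i + Suc d)"
    have d: "d < length (q ?t i)"
      using Q(5)[of i "i + Suc d"] by simp
    show ?thesis
    proof (cases "s \<le> ?t")
      case True
      then show ?thesis using sext_nth[OF q_mono[OF True] that] unfolding f_def by argo
    next
      case False
      then have "sext (q ?t i) (q s i)"
        by (intro q_mono) simp
      then show ?thesis using sext_nth[OF _ d, of "q s i"] unfolding f_def by argo
    qed
  qed
  have extends: "extends N (g s) (q s) E f" for N s
    unfolding extends_def using E f by simp
  \<comment> \<open>Truth implies forcing: the finite use of \<open>\<phi>\<close> is covered by a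
    late enough stage.\<close>
  have eventually_forced: "\<exists>s\<ge>t. forced N \<phi> (g s) (q s)" if \<phi>: "finitary N \<phi>" "\<phi> E f" for N \<phi> t
  proof -
    obtain n where n: "\<And>E' f'. agree N n E f E' f' \<Longrightarrow> \<phi> E' f'"
      using \<phi> unfolding finitary_def by blast
    define s where "s = N + n + t"
    have "agree N n E f E' f'" if e: "extends N (g (Suc s)) (q (Suc s)) E' f'" for E' f'
      unfolding agree_def
    proof (intro conjI allI impI)
      fix a b assume "a < n" "b < n"
      then have "a < fst (g (Suc s))" "b < fst (g (Suc s))"
        using Q(4)[of s] by (auto simp: s_def)
      then show "(a, b) \<in> E \<longleftrightarrow> (a, b) \<in> E'"
        using e extends[of N "Suc s"] unfolding extends_def by blast
    next
      fix i d assume "i < N" "d < n"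
      moreover have "d < length (q (Suc s) i)"
        using Q(5)[of i s] \<open>i < N\<close> \<open>d < n\<close> by (simp add: s_def)
      ultimately show "f i d = f' i d"
        using e extends[of N "Suc s"] unfolding extends_def by simp
    qed
    then have "forced N \<phi> (g (Suc s)) (q (Suc s))"
      unfolding forced_def using n by blast
    then show ?thesis
      by (intro exI[of _ "Suc s"]) (simp add: s_def)
  qed
  show thesis
  proof (rule that; (intro allI)?)
    show "sym E"
      unfolding E_def using fg unfolding is_fgraph_def by (intro sym_UNION) blast
    show "\<exists>c. proper (E \<inter> ({..<n} \<times> {..<n})) c" for n
    proof -
      obtain c where "proper (snd (g (Suc n))) c"
        using fg[of "Suc n"] unfolding is_fgraph_def by blast
      moreover have "{..<n} \<subseteq> {..<fst (g (Suc n))}"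
        using Q(4)[of n] by simp
      then have "E \<inter> ({..<n} \<times> {..<n}) \<subseteq> E \<inter> ({..<fst (g (Suc n))} \<times> {..<fst (g (Suc n))})"
        by (intro Int_mono Sigma_mono) simp_all
      then have "E \<inter> ({..<n} \<times> {..<n}) \<subseteq> snd (g (Suc n))"
        unfolding E .
      ultimately show ?thesis
        unfolding proper_def by blast
    qed
    show "h_bounded h (f i)" for i
      unfolding h_bounded_def
    proof
      fix d
      let ?t = "Suc (i + Suc d)"
      have "d < length (q ?t i)"
        using Q(5)[of i "i + Suc d"] by simp
      moreover have "sext [] (q ?t i)"
        using cond[of ?t] unfolding cond_def by simp
      ultimately show "f i d \<le> h d"
        unfolding sext_Nil f_def by blast
    qed
    show "\<Psi> i E f d \<noteq> Some (f i d)" for i d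
    proof
      assume "\<Psi> i E f d = Some (f i d)"
      then obtain s where s: "s \<ge> Suc (i + Suc d)"
          "forced i (\<lambda>E' f'. \<Psi> i E' f' d = Some (f i d)) (g s) (q s)"
        using eventually_forced[OF \<Psi>, of i d "f i d" "Suc (i + Suc d)"] by blast
      have "d < length (q (Suc (i + Suc d)) i)"
        using Q(5)[of i "i + Suc d"] by simp
      also have "\<dots> \<le> length (q s i)"
        using s(1) by (intro sext_length q_mono)
      finally have d: "d < length (q s i)" .
      \<comment> \<open>Bad sets only grow, so a forced agreement would put this later condition
        into its own bad set.\<close>
      then have "D i (g s) (q s)"
        unfolding D_def using s(2) f[OF d] by metis
      then have "B (Suc i) (g s) (q s)"
        using Q(3) by blast
      then show False
        using B_mono not_B s(1) by (meson Suc_le_mono le_add1 le_trans)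
    qed
    show "finite (H s E f) \<or> (\<exists>u\<in>H s E f. \<exists>v\<in>H s E f. \<exists>n. u < n \<and> v < n \<and>
       (\<forall>c. proper (E \<inter> ({..<n} \<times> {..<n})) c \<longrightarrow> c u \<noteq> c v))" for s
      using Q(6)[of s] unfolding met_def
    proof (elim disjE exE conjE)
      fix m assume m: "\<forall>g r u. m \<le> u \<and> u < fst g \<and> F s u g r \<longrightarrow> B (Suc s) g r"
      have "u < m" if u: "u \<in> H s E f" for u
      proof (rule ccontr)
        assume "\<not> u < m"
        \<comment> \<open>The stage is taken late enough for \<open>u\<close> to be a vertex of the
          current graph, as the clause on bad extensions demands.\<close>
        obtain t where t: "t \<ge> Suc (Suc u + s)" "F s u (g t) (q t)"
          unfolding F_def using eventually_forced[OF H u, of "Suc (Suc u + s)"] by blast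
        have "Suc u + s \<le> fst (g (Suc (Suc u + s)))"
          by (rule Q(4))
        also have "\<dots> \<le> fst (g t)"
          using t(1) gext_le[OF g_mono] by blast
        finally have "u < fst (g t)"
          by simp
        then have "B (Suc s) (g t) (q t)"
          using m t(2) \<open>\<not> u < m\<close> by (meson not_less)
        then show False
          using B_mono[of "Suc s" "g t" "q t" t] not_B[of t] t(1) by simp
      qed
      then have "H s E f \<subseteq> {..<m}"
        by blast
      then show ?thesis
        using finite_subset by blast
    next
      fix u v
      assume uv: "F s u (g (Suc s)) (q (Suc s))" "F s v (g (Suc s)) (q (Suc s))"
        "u < fst (g (Suc s))" "v < fst (g (Suc s))"
        "\<forall>c. proper (snd (g (Suc s))) c \<longrightarrow> c u \<noteq> c v"
      then have "u \<in> H s E f" "v \<in> H s E f"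
        using extends unfolding F_def forced_def by blast+
      then show ?thesis
        using uv(3-5) E[of "Suc s"] by metis
    qed
  qed
qed

end

section \<open>The ideal generated by the generic sequence\<close>

lemma finitary_mono:
  assumes "finitary N \<phi>" "N \<le> M"
  shows "finitary M \<phi>"
proof -
  have "agree N n E f E' f'" if "agree M n E f E' f'" for n E f E' f'
    using that assms(2) unfolding agree_def by auto
  then show ?thesis
    using assms(1) unfolding finitary_def by meson
qed

primrec tower :: "(nat \<times> nat) set \<Rightarrow> (nat \<Rightarrow> nat \<Rightarrow> nat) \<Rightarrow> nat \<Rightarrow> nat set" where
  "tower E f 0 = rel_code E"
| "tower E f (Suc j) = turing_join (tower E f j) (fun_code (f j))"

lemma mem_rel_code: "m \<in> rel_code R \<longleftrightarrow> prod_decode m \<in> R"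
  unfolding rel_code_def by (metis image_iff prod_decode_inverse prod_encode_inverse)

lemma mem_fun_code: "m \<in> fun_code f \<longleftrightarrow> snd (prod_decode m) = f (fst (prod_decode m))"
  unfolding fun_code_def mem_rel_code by (simp add: case_prod_beta)

text \<open>Decoding never leads above \<open>m\<close>: halving does not increase a number, and a
  pair's code bounds its components.\<close>

lemma tower_agree:
  assumes "agree j n E f E' f'" "m < n"
  shows "m \<in> tower E' f' j \<longleftrightarrow> m \<in> tower E f j"
  using assms
proof (induction j arbitrary: m)
  case 0
  obtain a b where ab: "prod_decode m = (a, b)"
    by fastforce
  then have "a < n" "b < n"
    using prod_decode_le[of m] 0 by auto
  then show ?case
    using 0 ab by (simp add: mem_rel_code agree_def)
next
  case (Suc j)
  have j: "agree j n E f E' f'" and fj: "\<And>d. d < n \<Longrightarrow> f j d = f' j d"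
    using Suc.prems(1) by (auto simp: agree_def)
  have "m div 2 < n"
    using Suc.prems(2) by simp
  then have "m div 2 \<in> tower E' f' j \<longleftrightarrow> m div 2 \<in> tower E f j"
    using Suc.IH j by blast
  moreover have "fst (prod_decode (m div 2)) < n"
    using prod_decode_le(1)[of "m div 2"] \<open>m div 2 < n\<close> by simp
  then have "m div 2 \<in> fun_code (f' j) \<longleftrightarrow> m div 2 \<in> fun_code (f j)"
    using fj by (simp add: mem_fun_code)
  ultimately show ?case
    by (simp add: mem_turing_join)
qed

lemma finitary_eval: "finitary j (\<lambda>E f. eval (tower E f j) p n = Some y)"
  unfolding finitary_def
proof (intro allI impI)
  fix E f assume "eval (tower E f j) p n = Some y"
  then obtain b where b: "\<forall>Y. agree_below b (tower E f j) Y \<longrightarrow> eval Y p n = Some y"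
    using eval_use by blast
  have "eval (tower E' f' j) p n = Some y" if "agree j b E f E' f'" for E' f'
    using b tower_agree[OF that] unfolding agree_below_def by blast
  then show "\<exists>n'. \<forall>E' f'. agree j n' E f E' f' \<longrightarrow> eval (tower E' f' j) p n = Some y"
    by blast
qed

lemma turing_le_tower:
  assumes "i \<le> j"
  shows "turing_le (tower E f i) (tower E f j)"
  using assms
proof (induction rule: dec_induct)
  case base
  show ?case by (rule turing_le_refl)
next
  case (step j)
  then show ?case
    using turing_le_join1 turing_le_trans by (metis tower.simps(2))
qed

definition tower_ideal :: "(nat \<times> nat) set \<Rightarrow> (nat \<Rightarrow> nat \<Rightarrow> nat) \<Rightarrow> nat set set" where
  "tower_ideal E f = {X. \<exists>j. turing_le X (tower E f j)}"

lemma turing_ideal_tower: "turing_ideal (tower_ideal E f)"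
  unfolding turing_ideal_def
proof (intro conjI ballI allI impI)
  show "tower_ideal E f \<noteq> {}"
    unfolding tower_ideal_def using turing_le_refl by blast
next
  fix X Y assume "X \<in> tower_ideal E f" "Y \<in> tower_ideal E f"
  then obtain i j where "turing_le X (tower E f i)" "turing_le Y (tower E f j)"
    unfolding tower_ideal_def by blast
  then have "turing_le X (tower E f (max i j))" "turing_le Y (tower E f (max i j))"
    using turing_le_trans turing_le_tower max.cobounded1 max.cobounded2 by blast+
  then show "turing_join X Y \<in> tower_ideal E f"
    unfolding tower_ideal_def using turing_join_le by blast
next
  fix X Y assume "Y \<in> tower_ideal E f" "turing_le X Y"
  then show "X \<in> tower_ideal E f"
    unfolding tower_ideal_def using turing_le_trans by blast
qed

theorem theorem4p1:
  fixes h :: "nat \<Rightarrow> nat"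
  assumes "is_order h" and "computable h" and "0 < h 0"
  shows "\<exists>S. turing_ideal S \<and> models_DNC S h \<and> \<not> models_RCOLOR S 2"
proof -
  interpret order_bound h
    using assms by unfold_locales
  \<comment> \<open>If the program coded in \<open>i\<close> decides \<open>X\<close> from its level
    of the tower, this is the diagonal \<open>Phi d X d\<close>. A code bounds its components, so
    that level is at most \<open>i\<close> and does not involve \<open>f i\<close>.\<close>
  define \<Psi> where "\<Psi> i E f d = eval (tower E f (fst (prod_decode i)))
      (oracle_subst (decode (snd (prod_decode i))) (decode d)) d" for i E f d
  \<comment> \<open>Programs that decide no set are included too; their enumerated sets are treated
    in the same way.\<close>
  define Hs where "Hs s E f =
      {u. eval (tower E f (fst (prod_decode s))) (decode (snd (prod_decode s))) u = Some 1}" for s E f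
  have \<Psi>: "finitary i (\<lambda>E f. \<Psi> i E f d = Some y)" for i d y
    unfolding \<Psi>_def using finitary_eval prod_decode_le(1) by (rule finitary_mono)
  have Hs: "finitary (Suc s) (\<lambda>E f. u \<in> Hs s E f)" for s u
    unfolding Hs_def mem_Collect_eq
    using finitary_eval le_SucI[OF prod_decode_le(1)] by (rule finitary_mono)
  obtain E f where sym: "sym E" and col: "\<forall>n. \<exists>c. proper (E \<inter> ({..<n} \<times> {..<n})) c"
    and bd: "\<forall>i. h_bounded h (f i)" and dnc: "\<forall>i d. \<Psi> i E f d \<noteq> Some (f i d)"
    and hom: "\<forall>s. finite (Hs s E f) \<or> (\<exists>u\<in>Hs s E f. \<exists>v\<in>Hs s E f. \<exists>n. u < n \<and> v < n \<and>
       (\<forall>c. proper (E \<inter> ({..<n} \<times> {..<n})) c \<longrightarrow> c u \<noteq> c v))"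
    by (rule generic_graph[of \<Psi> Hs, OF \<Psi> Hs])
  let ?S = "tower_ideal E f" and ?G = "(UNIV, E) :: ugraph"
  have "models_DNC ?S h"
    unfolding models_DNC_def
  proof
    fix X assume "X \<in> ?S"
    then obtain m e where me: "decides (tower E f m) (decode e) X"
      unfolding tower_ideal_def turing_le_decode by blast
    define i where "i = prod_encode (m, e)"
    have "\<Psi> i E f d = Phi d X d" for d
      unfolding \<Psi>_def Phi_def i_def by (simp add: eval_oracle_subst[OF me])
    then have "dnc (f i) X"
      unfolding dnc_def using dnc by metis
    moreover have "turing_le (fun_code (f i)) (tower E f (Suc i))"
      unfolding tower.simps by (rule turing_le_join2)
    then have "fun_code (f i) \<in> ?S"
      unfolding tower_ideal_def by blast
    ultimately show "\<exists>f. fun_code f \<in> ?S \<and> h_bounded h f \<and> dnc f X"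
      using bd by blast
  qed
  moreover have "\<not> models_RCOLOR ?S 2"
  proof
    assume R: "models_RCOLOR ?S 2"
    have "(a, a) \<notin> E" for a
      using spec[OF col, of "Suc a"] unfolding proper_def by auto
    then have "is_graph ?G"
      using sym unfolding is_graph_def irrefl_def by simp
    moreover have "locally_colorable 2 ?G"
      unfolding locally_colorable_def
    proof (intro allI impI, elim conjE)
      fix F assume F: "subgraph F ?G" "finite (fst F)"
      obtain n where n: "fst F \<subseteq> {..<n}"
        using F(2) unfolding finite_nat_set_iff_bounded by blast
      obtain c where c: "proper (E \<inter> ({..<n} \<times> {..<n})) c"
        using col by blast
      have "snd F \<subseteq> E \<inter> ({..<n} \<times> {..<n})"
        using F(1) n unfolding subgraph_def is_graph_def by auto
      then have "c u \<noteq> c v" if "(u, v) \<in> snd F" for u v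
        using c that unfolding proper_def by blast
      then have "coloring 2 F (\<lambda>v. if c v then 1 else 0)"
        unfolding coloring_def by auto
      then show "\<exists>c. coloring 2 F c"
        by (rule exI[of "coloring 2 F"])
    qed
    moreover have "graph_in ?G ?S"
      unfolding graph_in_def tower_ideal_def
      using turing_le_UNIV turing_le_refl[of "rel_code E"] tower.simps(1)[of E f]
      by (metis (mono_tags) fst_conv mem_Collect_eq snd_conv)
    moreover have "infinite (fst ?G)"
      by simp
    ultimately obtain X where X: "X \<in> ?S" "infinite X" "homogeneous 2 ?G X"
      using R unfolding models_RCOLOR_def by blast
    obtain m e where me: "decides (tower E f m) (decode e) X"
      using X(1) unfolding tower_ideal_def turing_le_decode by blast
    have "Hs (prod_encode (m, e)) E f = X"
      using me unfolding Hs_def decides_def by auto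
    then obtain u v n where uv: "u \<in> X" "v \<in> X" "u < n" "v < n"
      and split: "\<And>c. proper (E \<inter> ({..<n} \<times> {..<n})) c \<Longrightarrow> c u \<noteq> c v"
      using spec[OF hom, of "prod_encode (m, e)"] X(2) by auto
    \<comment> \<open>Homogeneity on \<open>{..<n}\<close> gives both \<open>u\<close> and
      \<open>v\<close> colour 0, contrary to \<open>split\<close>; it remains to read the colouring
      as a boolean one.\<close>
    obtain c where c: "coloring 2 (induced ?G {..<n}) c" "\<forall>v\<in>{..<n} \<inter> X. c v = 0"
      using X(3) unfolding homogeneous_def by auto
    have "(c a = 0) \<noteq> (c b = 0)" if "(a, b) \<in> E" "a < n" "b < n" for a b
    proof -
      have "c a < 2" "c b < 2" "c a \<noteq> c b"
        using c(1) that unfolding coloring_def induced_def by auto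
      then show ?thesis by linarith
    qed
    then have "proper (E \<inter> ({..<n} \<times> {..<n})) (\<lambda>x. c x = 0)"
      unfolding proper_def by (intro ballI) (simp add: split_paired_all)
    then show False
      using split c(2) uv by blast
  qed
  ultimately show ?thesis
    using turing_ideal_tower by blast
qed

end
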